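(* There are numerical constants $c_0,c_1>0$ such that, for every $\ell,D_{\mathcal Y},\Delta,\epsilon>0$ satisfying $\epsilon\le c_0\min\{\ell D_{\mathcal Y},\sqrt{\ell\Delta}\}$, there exists an instance $f\in\mathcal F(\ell,D_{\mathcal Y},\Delta)$ for which $$\mathcal T_\epsilon\bigl(\mathcal A_{\rm zr}\cap\mathcal A_{\rm det},\{f\}\bigr)\ \ge\ c_1\,\frac{\ell^2D_{\mathcal Y}\Delta}{\epsilon^3}.$$
   Context: All norms are Euclidean. Function class. For $\ell,D_{\mathcal Y},\Delta>0$, $\mathcal F(\ell,D_{\mathcal Y},\Delta)$ is the class of all functions $f:\mathcal X\times\mathcal Y\to\mathbb R$, over all $m,n\in\mathbb N$ and all nonempty closed convex $\mathcal X\subseteq\mathbb R^m$, $\mathcal Y\subseteq\mathbb R^n$ with $(\mathbf 0,\mathbf 0)\in\mathcal X\times\mathcal Y$ and $\operatorname{diam}(\mathcal Y)\le D_{\mathcal Y}$, such that: (i) $f$ is jointly $\ell$-smooth: $\|\nabla f(x_1;y_1)-\nabla f(x_2;y_2)\|\le\ell\|(x_1,y_1)-(x_2,y_2)\|$ on $\mathcal X\times\mathcal Y$; (ii) $f(x;\cdot)$ is concave on $\mathcal Y$ for every $x\in\mathcal X$; (iii) $\Phi(\mathbf 0)-\inf_{x\in\mathcal X}\Phi(x)\le\Delta$, where $\Phi(x):=\max_{y\in\mathcal Y}f(x;y)+\iota_{\mathcal X}(x)$ and $\iota_{\mathcal X}$ is $0$ on $\mathcal X$ and $+\infty$ outside.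 Stationarity. The Moreau envelope is $\Phi_{1/(2\ell)}(x):=\min_{z\in\mathbb R^m}\{\Phi(z)+\ell\|x-z\|^2\}$. A point $x\in\mathcal X$ is $\epsilon$-OS for $f$ if $\|\nabla\Phi_{1/(2\ell)}(x)\|\le\epsilon$. Oracle and algorithms. The first-order saddle oracle at $(x,y)\in\mathcal X\times\mathcal Y$ returns $\mathbb O_f(x;y)=(f(x;y),\nabla_xf(x;y),\nabla_yf(x;y))$. For a first-order algorithm $\mathsf A$ and a differentiable $f:\mathcal X\times\mathcal Y\to\mathbb R$, $(\mathsf A_x^{(t)}[f],\mathsf A_y^{(t)}[f])\in\mathcal X\times\mathcal Y$ is its $t$-th (feasible) query, $t=0,1,2,\dots$; the domain $\mathcal X\times\mathcal Y$ is known to the algorithm. $\mathcal A_{\rm det}$ (deterministic algorithms): there are maps $\{\Gamma_t\}_{t\ge1}$ such that for every $f$ the initial query is $(\mathbf 0,\mathbf 0)$ and for $t\ge1$ the $t$-th query equals $\Gamma_t\bigl((\mathbb O_f(\mathsf A_x^{(s)}[f];\mathsf A_y^{(s)}[f]))_{s<t}\bigr)$. $\mathcal A_{\rm zr}$ (zero-respecting algorithms): for every $f$ the initial query is $(\mathbf 0,\mathbf 0)$ and for all $t\ge1$, $\operatorname{supp}(\mathsf A_x^{(t)}[f],\mathsf A_y^{(t)}[f])\subseteq\bigcup_{s<t}\operatorname{supp}\bigl(\nabla_xf,\nabla_yf\bigr)(\mathsf A_x^{(s)}[f];\mathsf A_y^{(s)}[f])$, where $\operatorname{supp}$ is the set of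 indices of nonzero coordinates of the concatenated vector. Complexity. For nonempty $\mathcal A\subseteq\mathcal A_{\rm det}$ and a nonempty function class $\mathcal G$, $\mathcal T_\epsilon(\mathcal A,\mathcal G):=\inf_{\mathsf A\in\mathcal A}\sup_{f\in\mathcal G}\inf\{t\in\{0,1,2,\dots\}:\mathsf A_x^{(t)}[f]\text{ is }\epsilon\text{-OS for }f\}$ (with $\inf\varnothing=+\infty$). *)

theory Defs
  imports
    "HOL-Analysis.L2_Norm"
    "HOL-Analysis.Abstract_Metric_Spaces"
    "HOL-Library.Extended_Real"
    "Jordan_Normal_Form.Matrix"
begin

unbundle no vec_syntax

text \<open>
  The dimensions \<open>m\<close>, \<open>n\<close> vary over the instances of one class, so a point of \<open>\<real>\<^sup>N\<close> is an element of
  \<^term>\<open>carrier_vec N :: real vec set\<close>, and \<open>(x, y)\<close> as a single vector is \<open>x @\<^sub>v y\<close>.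
\<close>

subsection \<open>Euclidean space with explicit dimension\<close>

definition vnorm :: "real vec \<Rightarrow> real" where
  "vnorm v = L2_set (\<lambda>i. v $ i) {..<dim_vec v}"

text \<open>
  The Euclidean distance, written so that it is nonnegative and symmetric for all arguments, as the
  locale \<^locale>\<open>Metric_space\<close> requires; on \<^term>\<open>carrier_vec N\<close> it is the norm of the difference
  (lemma \<open>vdist_eq_vnorm\<close>).
\<close>
definition vdist :: "nat \<Rightarrow> real vec \<Rightarrow> real vec \<Rightarrow> real" where
  "vdist N v w = L2_set (\<lambda>i. v $ i - w $ i) {..<N}"

definition supp :: "real vec \<Rightarrow> nat set" where
  "supp v = {i. i < dim_vec v \<and> v $ i \<noteq> 0}"

definition convex_vec :: "real vec set \<Rightarrow> bool" where
  "convex_vec S \<longleftrightarrow>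
     (\<forall>v\<in>S. \<forall>w\<in>S. \<forall>t\<in>{0..1}. (1 - t) \<cdot>\<^sub>v v + t \<cdot>\<^sub>v w \<in> S)"

definition concave_on_vec :: "real vec set \<Rightarrow> (real vec \<Rightarrow> real) \<Rightarrow> bool" where
  "concave_on_vec S h \<longleftrightarrow>
     (\<forall>v\<in>S. \<forall>w\<in>S. \<forall>t\<in>{0..1}. (1 - t) * h v + t * h w \<le> h ((1 - t) \<cdot>\<^sub>v v + t \<cdot>\<^sub>v w))"

definition closed_vec :: "nat \<Rightarrow> real vec set \<Rightarrow> bool" where
  "closed_vec N S \<longleftrightarrow> closedin (Metric_space.mtopology (carrier_vec N) (vdist N)) S"

definition diam_vec :: "real vec set \<Rightarrow> ereal" where
  "diam_vec S = (SUP v\<in>S. SUP w\<in>S. ereal (vnorm (v - w)))"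

text \<open>
  Gradient at \<open>z\<close> of a function on a set \<open>S \<subseteq> \<real>\<^sup>N\<close>; only the values of \<open>h\<close> on \<open>S\<close> matter.  The middle
  conjunct is differentiability of \<open>h\<close> at \<open>z\<close> within \<open>S\<close>.  The last one says that \<open>g\<close> lies
  in the linear span of \<open>S - z\<close> (as the double orthogonal complement of \<open>S - z\<close>).  It holds
  automatically when \<open>S\<close> has interior points; when \<open>S\<close> lies in a proper affine subspace, where
  differentiability within \<open>S\<close> leaves the component of \<open>g\<close> normal to the affine hull free, it sets
  that component to \<open>0\<close>.  For convex \<open>S\<close> the gradient is therefore unique.
\<close>
definition has_gradient ::
    "nat \<Rightarrow> real vec set \<Rightarrow> (real vec \<Rightarrow> real) \<Rightarrow> real vec \<Rightarrow> real vec \<Rightarrow> bool" where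
  "has_gradient N S h g z \<longleftrightarrow>
     g \<in> carrier_vec N \<and>
     (\<forall>e>0. \<exists>d>0. \<forall>w\<in>S. vnorm (w - z) < d \<longrightarrow>
        \<bar>h w - h z - scalar_prod g (w - z)\<bar> \<le> e * vnorm (w - z)) \<and>
     (\<forall>v\<in>carrier_vec N. (\<forall>w\<in>S. scalar_prod v (w - z) = 0) \<longrightarrow> scalar_prod v g = 0)"

definition gradient :: "nat \<Rightarrow> real vec set \<Rightarrow> (real vec \<Rightarrow> real) \<Rightarrow> real vec \<Rightarrow> real vec" where
  "gradient N S h z = (THE g. has_gradient N S h g z)"

subsection \<open>Saddle functions and first-order queries\<close>

text \<open>A function \<open>f : X \<times> Y \<rightarrow> \<real>\<close> with \<open>X \<subseteq> \<real>\<^sup>m\<close> and \<open>Y \<subseteq> \<real>\<^sup>n\<close>, together with its domain.\<close>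
record saddle =
  xdim :: nat
  ydim :: nat
  xdom :: "real vec set"
  ydom :: "real vec set"
  obj :: "real vec \<Rightarrow> real vec \<Rightarrow> real"

definition joint_dim :: "saddle \<Rightarrow> nat" where
  "joint_dim f = xdim f + ydim f"

definition joint_dom :: "saddle \<Rightarrow> real vec set" where
  "joint_dom f = {x @\<^sub>v y | x y. x \<in> xdom f \<and> y \<in> ydom f}"

definition joint_obj :: "saddle \<Rightarrow> real vec \<Rightarrow> real" where
  "joint_obj f z = obj f (vec_first z (xdim f)) (vec_last z (ydim f))"

definition grad :: "saddle \<Rightarrow> real vec \<Rightarrow> real vec \<Rightarrow> real vec" where
  "grad f x y = gradient (joint_dim f) (joint_dom f) (joint_obj f) (x @\<^sub>v y)"

definition grad_x :: "saddle \<Rightarrow> real vec \<Rightarrow> real vec \<Rightarrow> real vec" where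
  "grad_x f x y = vec_first (grad f x y) (xdim f)"

definition grad_y :: "saddle \<Rightarrow> real vec \<Rightarrow> real vec \<Rightarrow> real vec" where
  "grad_y f x y = vec_last (grad f x y) (ydim f)"

definition saddle_query :: "saddle \<Rightarrow> real vec \<times> real vec \<Rightarrow> real \<times> real vec \<times> real vec" where
  "saddle_query f = (\<lambda>(x, y). (obj f x y, grad_x f x y, grad_y f x y))"

definition admissible_domain :: "nat \<Rightarrow> real vec set \<Rightarrow> bool" where
  "admissible_domain N S \<longleftrightarrow>
     N \<ge> 1 \<and> S \<subseteq> carrier_vec N \<and> 0\<^sub>v N \<in> S \<and> closed_vec N S \<and> convex_vec S"

definition differentiable_saddle :: "saddle \<Rightarrow> bool" where
  "differentiable_saddle f \<longleftrightarrow>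
     admissible_domain (xdim f) (xdom f) \<and> admissible_domain (ydim f) (ydom f) \<and>
     (\<forall>z\<in>joint_dom f. \<exists>g. has_gradient (joint_dim f) (joint_dom f) (joint_obj f) g z)"

subsection \<open>Function class and stationarity\<close>

text \<open>
  The maximum over \<open>Y\<close> and the minimum in the Moreau envelope are written as supremum and infimum in
  the extended reals; both are attained for every member of the function class.
\<close>
definition primal :: "saddle \<Rightarrow> real vec \<Rightarrow> ereal" where
  "primal f x = (SUP y\<in>ydom f. ereal (obj f x y)) + (if x \<in> xdom f then 0 else \<infinity>)"

definition smooth_saddle :: "real \<Rightarrow> saddle \<Rightarrow> bool" where
  "smooth_saddle l f \<longleftrightarrow>
     (\<forall>x1\<in>xdom f. \<forall>y1\<in>ydom f. \<forall>x2\<in>xdom f. \<forall>y2\<in>ydom f.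
        vnorm (grad f x1 y1 - grad f x2 y2) \<le> l * vnorm ((x1 @\<^sub>v y1) - (x2 @\<^sub>v y2)))"

definition saddle_class :: "real \<Rightarrow> real \<Rightarrow> real \<Rightarrow> saddle set" where
  "saddle_class l D \<Delta> = {f.
     differentiable_saddle f \<and>
     diam_vec (ydom f) \<le> ereal D \<and>
     smooth_saddle l f \<and>
     (\<forall>x\<in>xdom f. concave_on_vec (ydom f) (obj f x)) \<and>
     primal f (0\<^sub>v (xdim f)) - (INF x\<in>xdom f. primal f x) \<le> ereal \<Delta>}"

text \<open>The envelope with parameter \<open>1 / (2 * l)\<close>.\<close>
definition moreau :: "real \<Rightarrow> saddle \<Rightarrow> real vec \<Rightarrow> ereal" where
  "moreau l f x = (INF z\<in>carrier_vec (xdim f). primal f z + ereal (l * (vnorm (x - z))\<^sup>2))"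

text \<open>
  On the function class the envelope is finite and differentiable everywhere, so the existential
  quantifier only names its gradient.
\<close>
definition eps_OS :: "real \<Rightarrow> real \<Rightarrow> saddle \<Rightarrow> real vec \<Rightarrow> bool" where
  "eps_OS l \<epsilon> f x \<longleftrightarrow> x \<in> xdom f \<and>
     (\<exists>g. has_gradient (xdim f) (carrier_vec (xdim f)) (\<lambda>u. real_of_ereal (moreau l f u)) g x \<and>
          vnorm g \<le> \<epsilon>)"

subsection \<open>Algorithms and complexity\<close>

text \<open>\<open>A f t\<close> is the \<open>t\<close>-th query of algorithm \<open>A\<close> when run on \<open>f\<close>.\<close>
type_synonym algorithm = "saddle \<Rightarrow> nat \<Rightarrow> real vec \<times> real vec"

definition first_order_algorithm :: "algorithm \<Rightarrow> bool" where
  "first_order_algorithm A \<longleftrightarrow>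
     (\<forall>f. differentiable_saddle f \<longrightarrow> (\<forall>t. A f t \<in> xdom f \<times> ydom f))"

text \<open>
  The maps \<open>\<Gamma> t\<close> take the domain as an argument because the domain is known to the algorithm; it
  determines the dimensions.
\<close>
definition A_det :: "algorithm set" where
  "A_det = {A. first_order_algorithm A \<and>
     (\<exists>\<Gamma> :: nat \<Rightarrow> real vec set \<Rightarrow> real vec set \<Rightarrow> (real \<times> real vec \<times> real vec) list
             \<Rightarrow> real vec \<times> real vec.
        \<forall>f. differentiable_saddle f \<longrightarrow>
          A f 0 = (0\<^sub>v (xdim f), 0\<^sub>v (ydim f)) \<and>
          (\<forall>t\<ge>1. A f t = \<Gamma> t (xdom f) (ydom f) (map (\<lambda>s. saddle_query f (A f s)) [0..<t])))}"

definition A_zr :: "algorithm set" where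
  "A_zr = {A. first_order_algorithm A \<and>
     (\<forall>f. differentiable_saddle f \<longrightarrow>
        A f 0 = (0\<^sub>v (xdim f), 0\<^sub>v (ydim f)) \<and>
        (\<forall>t\<ge>1. supp (fst (A f t) @\<^sub>v snd (A f t)) \<subseteq>
           (\<Union>s<t. supp (grad_x f (fst (A f s)) (snd (A f s)) @\<^sub>v
                         grad_y f (fst (A f s)) (snd (A f s))))))}"

text \<open>In \<^typ>\<open>ereal\<close> the infimum over the empty set is \<open>\<infinity>\<close>.\<close>
definition complexity :: "real \<Rightarrow> real \<Rightarrow> algorithm set \<Rightarrow> saddle set \<Rightarrow> ereal" where
  "complexity l \<epsilon> \<A> \<G> =
     (INF A\<in>\<A>. SUP f\<in>\<G>. INF t\<in>{t. eps_OS l \<epsilon> f (fst (A f t))}. ereal (real t))"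

subsection \<open>Well-definedness\<close>

lemma vdist_eq_vnorm:
  assumes "v \<in> carrier_vec N" "w \<in> carrier_vec N"
  shows "vdist N v w = vnorm (v - w)"
  using assms by (auto simp: vdist_def vnorm_def intro!: L2_set_cong)

lemma Metric_space_vdist: "Metric_space (carrier_vec N) (vdist N)"
proof
  fix v w u :: "real vec"
  show "0 \<le> vdist N v w"
    by (simp add: vdist_def)
  show "vdist N v w = vdist N w v"
    by (simp add: vdist_def L2_set_def power2_commute)
  assume "v \<in> carrier_vec N" "w \<in> carrier_vec N"
  then show "vdist N v w = 0 \<longleftrightarrow> v = w"
    by (auto simp: vdist_def L2_set_eq_0_iff)
  show "vdist N v u \<le> vdist N v w + vdist N w u"
    using L2_set_triangle_ineq[of "\<lambda>i. v $ i - w $ i" "\<lambda>i. w $ i - u $ i" "{..<N}"]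
    by (simp add: vdist_def)
qed

lemma vnorm_smult: "vnorm (t \<cdot>\<^sub>v v) = \<bar>t\<bar> * vnorm v"
proof -
  have "vnorm (t \<cdot>\<^sub>v v) = L2_set (\<lambda>i. t * v $ i) {..<dim_vec v}"
    unfolding vnorm_def by (auto intro: L2_set_cong)
  also have "\<dots> = \<bar>t\<bar> * vnorm v"
    by (simp add: vnorm_def L2_set_def power_mult_distrib real_sqrt_mult flip: sum_distrib_left)
  finally show ?thesis .
qed

lemma has_gradient_unique:
  assumes S: "S \<subseteq> carrier_vec N" "convex_vec S" "z \<in> S"
    and g: "has_gradient N S h g z" and k: "has_gradient N S h k z"
  shows "g = k"
proof -
  have gc: "g \<in> carrier_vec N" and kc: "k \<in> carrier_vec N"
    using g k by (auto simp: has_gradient_def)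
  have zc: "z \<in> carrier_vec N"
    using S by auto
  have orth: "scalar_prod (g - k) (w - z) = 0" if w: "w \<in> S" for w
  proof (rule ccontr)
    define u where "u = w - z"
    have wc: "w \<in> carrier_vec N"
      using S w by auto
    have uc: "u \<in> carrier_vec N"
      using wc zc by (simp add: u_def)
    assume "scalar_prod (g - k) (w - z) \<noteq> 0"
    then have pos: "\<bar>scalar_prod (g - k) u\<bar> > 0"
      by (simp add: u_def)
    have n0: "vnorm u \<ge> 0"
      by (simp add: vnorm_def)
    define e where "e = \<bar>scalar_prod (g - k) u\<bar> / (4 * (vnorm u + 1))"
    have e: "e > 0"
      using pos n0 by (simp add: e_def)
    obtain d1 where d1: "d1 > 0" "\<And>x. x \<in> S \<Longrightarrow> vnorm (x - z) < d1 \<Longrightarrow>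
        \<bar>h x - h z - scalar_prod g (x - z)\<bar> \<le> e * vnorm (x - z)"
      using g e unfolding has_gradient_def by meson
    obtain d2 where d2: "d2 > 0" "\<And>x. x \<in> S \<Longrightarrow> vnorm (x - z) < d2 \<Longrightarrow>
        \<bar>h x - h z - scalar_prod k (x - z)\<bar> \<le> e * vnorm (x - z)"
      using k e unfolding has_gradient_def by meson
    define d where "d = min d1 d2"
    define t where "t = min 1 (d / (2 * (vnorm u + 1)))"
    have d: "d > 0"
      using d1 d2 by (simp add: d_def)
    have t: "0 < t" "t \<le> 1"
      using d n0 by (auto simp: t_def)
    have tu: "t * vnorm u < d"
    proof -
      have "t * vnorm u \<le> d / (2 * (vnorm u + 1)) * vnorm u"
        using n0 by (intro mult_right_mono) (auto simp: t_def)
      also have "\<dots> < d"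
        using n0 d by (simp add: field_simps) (smt (verit) mult_nonneg_nonneg)
      finally show ?thesis .
    qed
    define x where "x = (1 - t) \<cdot>\<^sub>v z + t \<cdot>\<^sub>v w"
    have xS: "x \<in> S"
      using S w t unfolding x_def convex_vec_def by auto
    have xz: "x - z = t \<cdot>\<^sub>v u"
      using zc wc by (intro eq_vecI) (auto simp: x_def u_def algebra_simps)
    have nx: "vnorm (x - z) = t * vnorm u"
      using t by (simp add: xz vnorm_smult)
    have "\<bar>scalar_prod g (x - z) - scalar_prod k (x - z)\<bar> \<le> 2 * e * (t * vnorm u)"
      using d1(2)[OF xS] d2(2)[OF xS] tu unfolding nx d_def by linarith
    moreover have "scalar_prod g (x - z) - scalar_prod k (x - z) = t * scalar_prod (g - k) u"
      using gc kc uc by (simp add: xz minus_scalar_prod_distrib[of _ N] algebra_simps)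
    ultimately have "t * \<bar>scalar_prod (g - k) u\<bar> \<le> t * (2 * e * vnorm u)"
      using t by (simp add: abs_mult algebra_simps)
    then have le: "\<bar>scalar_prod (g - k) u\<bar> \<le> 2 * e * vnorm u"
      using t by simp
    have "2 * e * vnorm u < 4 * e * (vnorm u + 1)"
    proof -
      have "0 \<le> e * vnorm u"
        using e n0 by simp
      then show ?thesis
        using e by (simp add: algebra_simps)
    qed
    also have "\<dots> = \<bar>scalar_prod (g - k) u\<bar>"
      using n0 by (simp add: e_def divide_simps)
    finally show False
      using le by simp
  qed
  then have "scalar_prod (g - k) g = 0" "scalar_prod (g - k) k = 0"
    using g k gc kc unfolding has_gradient_def by (meson minus_carrier_vec)+
  then have "scalar_prod (g - k) (g - k) = 0"
    using gc kc by (simp add: scalar_prod_minus_distrib[of _ N])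
  then have "\<forall>i<N. (g $ i - k $ i)\<^sup>2 = 0"
    using gc kc by (auto simp: scalar_prod_def power2_eq_square sum_nonneg_eq_0_iff)
  then show ?thesis
    using gc kc by (intro eq_vecI) auto
qed

lemma admissible_algorithms_nonempty: "A_zr \<inter> A_det \<noteq> {}"
proof -
  define A :: algorithm where "A = (\<lambda>f t. (0\<^sub>v (xdim f), 0\<^sub>v (ydim f)))"
  have foa: "first_order_algorithm A"
    by (auto simp: first_order_algorithm_def A_def differentiable_saddle_def admissible_domain_def)
  have supp0: "supp (0\<^sub>v m @\<^sub>v 0\<^sub>v n) = {}" for m n
    by (auto simp: supp_def)
  have "A \<in> A_zr"
    using foa by (simp add: A_zr_def A_def supp0)
  moreover have "A \<in> A_det"
  proof -
    define \<Gamma> :: "nat \<Rightarrow> real vec set \<Rightarrow> real vec set \<Rightarrow> (real \<times> real vec \<times> real vec) list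
        \<Rightarrow> real vec \<times> real vec"
      where "\<Gamma> = (\<lambda>t X Y hs. (0\<^sub>v (dim_vec (SOME x. x \<in> X)), 0\<^sub>v (dim_vec (SOME y. y \<in> Y))))"
    have dim: "dim_vec (SOME x. x \<in> S) = N" if "admissible_domain N S" for N S
      using that unfolding admissible_domain_def by (metis carrier_vecD someI subsetD)
    have "\<forall>f. differentiable_saddle f \<longrightarrow> A f 0 = (0\<^sub>v (xdim f), 0\<^sub>v (ydim f)) \<and>
       (\<forall>t\<ge>1. A f t = \<Gamma> t (xdom f) (ydom f) (map (\<lambda>s. saddle_query f (A f s)) [0..<t]))"
      by (auto simp: A_def \<Gamma>_def differentiable_saddle_def dim)
    then show ?thesis
      using foa unfolding A_det_def by blast
  qed
  ultimately show ?thesis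
    by blast
qed

end

theory Submission
  imports Defs "HOL-Analysis.Convex"
begin

text \<open>
  On \<open>x \<ge> 0\<close> and a ball of radius \<open>D / 2\<close> in \<open>y\<close>, the objective is a bilinear term \<open>\<kappa> \<langle>y, B x\<rangle>\<close> minus a
  coordinatewise nondecreasing nonconvex function \<open>G x\<close>, so that \<open>\<Phi> x = \<kappa> (D / 2) \<parallel>B x\<parallel> - G x\<close>.  The
  coordinates form \<open>K \<approx> l \<Delta> / \<epsilon>\<^sup>2\<close> blocks of length \<open>L \<approx> l D / \<epsilon>\<close>.  \<open>B\<close> ties the coordinates of each block
  together, and its smallest nonzero singular value is of order \<open>1 / L\<close>; \<open>G\<close> rewards the first coordinate of
  a block for growing once the last coordinate of the previous block has grown to scale \<open>\<epsilon> / l\<close>.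

  If the last coordinate of \<open>x\<close> is zero and \<open>z\<close> is a near-minimizer of \<open>\<Phi> z + l \<parallel>x - z\<parallel>\<^sup>2\<close> with
  \<open>\<parallel>x - z\<parallel> \<le> \<epsilon> / l\<close>, then moving \<open>z\<close> upwards onto the kernel of \<open>B\<close> does not increase this function, because
  \<open>G\<close> is monotone and the norm outweighs the quadratic.  Afterwards each block is determined by one number,
  and lifting the first block that is still low decreases the function by a fixed amount, a contradiction.
  Hence \<open>x\<close> is not stationary, while a zero-respecting algorithm discovers at most one further index per
  query and needs \<open>K L\<close> queries to reach the last coordinate.
\<close>

subsection \<open>A smooth saturating ramp\<close>

text \<open>Concave, 0 at 0, constant from 1 on, with a 2-Lipschitz derivative. The slope at 0 is 2,
  not 0: the zero chain rests on products of two ramps, where each partial derivative keeps the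
  other factor.\<close>

definition ramp :: "real \<Rightarrow> real" where
  "ramp t = 1 - (max 0 (1 - t))\<^sup>2"

definition ramp' :: "real \<Rightarrow> real" where
  "ramp' t = 2 * max 0 (1 - t)"

lemma ramp_0 [simp]: "ramp 0 = 0"
  by (simp add: ramp_def)

lemma ramp_eq_1: "t \<ge> 1 \<Longrightarrow> ramp t = 1"
  by (simp add: ramp_def)

lemma ramp_le_1: "ramp t \<le> 1"
  by (simp add: ramp_def)

lemma ramp_nonneg: "t \<ge> 0 \<Longrightarrow> ramp t \<ge> 0"
  by (auto simp: ramp_def max_def power_le_one_iff abs_square_le_1)

lemma ramp_mono: "s \<le> t \<Longrightarrow> ramp s \<le> ramp t"
  by (auto simp: ramp_def intro!: power_mono)

lemma ramp'_nonneg: "ramp' t \<ge> 0"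
  by (simp add: ramp'_def)

lemma ramp'_le: "t \<ge> 0 \<Longrightarrow> ramp' t \<le> 2"
  by (simp add: ramp'_def)

lemma ramp'_lipschitz: "\<bar>ramp' s - ramp' t\<bar> \<le> 2 * \<bar>s - t\<bar>"
  unfolding ramp'_def by (smt (verit))

lemma ramp_lipschitz:
  assumes "s \<ge> 0" "t \<ge> 0"
  shows "\<bar>ramp s - ramp t\<bar> \<le> 2 * \<bar>s - t\<bar>"
proof -
  have "\<bar>ramp s - ramp t\<bar> = \<bar>max 0 (1 - t) - max 0 (1 - s)\<bar> * \<bar>max 0 (1 - t) + max 0 (1 - s)\<bar>"
    unfolding abs_mult[symmetric] by (simp add: ramp_def power2_eq_square algebra_simps)
  also have "\<dots> \<le> \<bar>s - t\<bar> * 2"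
    using assms by (intro mult_mono) auto
  finally show ?thesis by simp
qed

text \<open>This is the remainder bound for a 2-Lipschitz derivative; the cases locate
  \<open>s\<close> and \<open>t\<close> relative to the kink of \<open>ramp'\<close> at 1.\<close>

lemma ramp_taylor: "\<bar>ramp s - ramp t - ramp' t * (s - t)\<bar> \<le> (s - t)\<^sup>2"
proof -
  consider "t \<ge> 1" "s \<ge> 1" | "t \<ge> 1" "s < 1" | "t < 1" "s < 1" | "t < 1" "s \<ge> 1"
    by linarith
  then show ?thesis
  proof cases
    case 2
    then have "(1 - s)\<^sup>2 \<le> (s - t)\<^sup>2"
      by (simp add: abs_le_square_iff[symmetric])
    with 2 show ?thesis by (simp add: ramp_def ramp'_def)
  next
    case 3
    then have "ramp s - ramp t - ramp' t * (s - t) = - (s - t)\<^sup>2"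
      by (simp add: ramp_def ramp'_def power2_eq_square algebra_simps)
    then show ?thesis by simp
  next
    case 4
    \<comment> \<open>With \<open>a = 1 - t\<close> and \<open>b = s - t\<close>, where
      \<open>0 < a \<le> b\<close>, the remainder is \<open>a * a - 2 * a * b\<close>, which lies
      between \<open>- b * b\<close> and 0.\<close>
    then have "(1 - t) * (1 - t) \<le> (1 - t) * (s - t)"
      by (intro mult_left_mono) auto
    moreover have "0 \<le> (1 - t) * (s - t)"
      using 4 by auto
    moreover have "(s - t)\<^sup>2 + (1 - t)\<^sup>2 - 2 * ((1 - t) * (s - t)) = ((1 - t) - (s - t))\<^sup>2"
      by (simp add: power2_eq_square algebra_simps)
    then have "0 \<le> (s - t)\<^sup>2 + (1 - t)\<^sup>2 - 2 * ((1 - t) * (s - t))"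
      by simp
    moreover have "ramp s - ramp t - ramp' t * (s - t) = (1 - t)\<^sup>2 - 2 * ((1 - t) * (s - t))"
      using 4 by (simp add: ramp_def ramp'_def)
    ultimately show ?thesis
      unfolding power2_eq_square by linarith
  qed (simp add: ramp_def ramp'_def)
qed

text \<open>Up to \<open>s + d \<le> 1\<close> the ramp is quadratic with average slope
  \<open>2 - 2 * s - d\<close>, which is at least 1/2 here.\<close>

lemma ramp_increment:
  assumes "0 \<le> s" "s \<le> 1/2" "0 \<le> d" "d \<le> 1/2"
  shows "ramp (s + d) - ramp s \<ge> d / 2"
proof -
  have "ramp (s + d) - ramp s = d * (2 - 2 * s - d)"
    using assms by (simp add: ramp_def power2_eq_square algebra_simps)
  also have "\<dots> \<ge> d * (1/2)"
    using assms by (intro mult_left_mono) auto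
  finally show ?thesis by simp
qed

lemma ramp_product_taylor:
  assumes "a \<ge> 0" "b \<ge> 0" "a' \<ge> 0" "b' \<ge> 0"
  shows "\<bar>ramp a' * ramp b' - ramp a * ramp b
    - ramp' a * ramp b * (a' - a) - ramp a * ramp' b * (b' - b)\<bar> \<le> 3 * (a' - a)\<^sup>2 + 3 * (b' - b)\<^sup>2"
proof -
  define u v where "u = ramp a' - ramp a" and "v = ramp b' - ramp b"
  define r s where "r = u - ramp' a * (a' - a)" and "s = v - ramp' b * (b' - b)"
  have r: "\<bar>r\<bar> \<le> (a' - a)\<^sup>2" and s: "\<bar>s\<bar> \<le> (b' - b)\<^sup>2"
    using ramp_taylor[of a' a] ramp_taylor[of b' b] by (auto simp: r_def s_def u_def v_def)
  have uv: "\<bar>u\<bar> \<le> 2 * \<bar>a' - a\<bar>" "\<bar>v\<bar> \<le> 2 * \<bar>b' - b\<bar>"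
    using ramp_lipschitz assms by (auto simp: u_def v_def)
  \<comment> \<open>The remainder of a product is the product of the increments plus both
    remainders, each weighted by a factor in [0, 1]. The product of the increments costs 2 for each
    square, each remainder 1.\<close>
  have "ramp a' * ramp b' - ramp a * ramp b - ramp' a * ramp b * (a' - a) - ramp a * ramp' b * (b' - b)
      = u * v + ramp b * r + ramp a * s"
    by (simp add: u_def v_def r_def s_def algebra_simps)
  also have "\<bar>\<dots>\<bar> \<le> \<bar>u\<bar> * \<bar>v\<bar> + ramp b * \<bar>r\<bar> + ramp a * \<bar>s\<bar>"
    using assms by (intro order_trans[OF abs_triangle_ineq] add_mono) (auto simp: abs_mult ramp_nonneg)
  also have "\<dots> \<le> (2 * \<bar>a' - a\<bar>) * (2 * \<bar>b' - b\<bar>) + 1 * (a' - a)\<^sup>2 + 1 * (b' - b)\<^sup>2"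
    using assms r s uv by (intro add_mono mult_mono) (auto simp: ramp_nonneg ramp_le_1)
  also have "\<dots> \<le> 3 * (a' - a)\<^sup>2 + 3 * (b' - b)\<^sup>2"
    using sum_squares_ge_zero[of "\<bar>a' - a\<bar> - \<bar>b' - b\<bar>" 0]
    by (simp add: power2_eq_square algebra_simps)
  finally show ?thesis .
qed

subsection \<open>The instance on coordinate sequences\<close>

text \<open>Truncation at \<open>j = 0\<close> counts \<open>u 0\<close> twice, hence the factor
  2.\<close>

lemma sum_lessThan_pred:
  fixes u :: "nat \<Rightarrow> real"
  assumes "\<And>j. j < n \<Longrightarrow> u j \<ge> 0"
  shows "(\<Sum>j<n. u (j - 1)) \<le> 2 * (\<Sum>j<n. u j)"
proof (cases n)
  case (Suc m)
  have "u 0 \<le> (\<Sum>j<n. u j)"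
    using assms Suc by (intro member_le_sum) auto
  moreover have "(\<Sum>j<m. u j) \<le> (\<Sum>j<n. u j)"
    using assms Suc by (intro sum_mono2) auto
  moreover have "(\<Sum>j<n. u (j - 1)) = u 0 + (\<Sum>j<m. u j)"
    unfolding Suc by (subst sum.lessThan_Suc_shift) simp
  ultimately show ?thesis by simp
qed simp

lemma sum_lessThan_if_Suc:
  fixes u :: "nat \<Rightarrow> real"
  assumes "u 0 = 0"
  shows "(\<Sum>j<n. if Suc j < n then u (Suc j) else 0) = (\<Sum>j<n. u j)"
proof (cases n)
  case (Suc m)
  have "(\<Sum>j<n. if Suc j < n then u (Suc j) else 0) = (\<Sum>j<m. u (Suc j))"
    unfolding Suc by simp
  also have "\<dots> = (\<Sum>j<n. u j)"
    unfolding Suc by (simp add: sum.lessThan_Suc_shift assms del: sum.lessThan_Suc)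
  finally show ?thesis .
qed simp

lemma square_sum2_le: "(a + b)\<^sup>2 \<le> 2 * a\<^sup>2 + 2 * b\<^sup>2" for a b :: real
  using zero_le_power2[of "a - b"] by (simp add: power2_sum power2_diff)

lemma square_sum3_le: "(a + b + c)\<^sup>2 \<le> 3 * a\<^sup>2 + 3 * b\<^sup>2 + 3 * c\<^sup>2" for a b c :: real
  using zero_le_power2[of "a - b"] zero_le_power2[of "b - c"] zero_le_power2[of "a - c"]
  by (simp add: power2_sum power2_diff algebra_simps)

locale hard_instance =
  fixes l D eps :: real and L K :: nat
  assumes l_pos: "l > 0" and D_pos: "D > 0" and eps_pos: "eps > 0"
    and L_pos: "L > 0" and K_pos: "K > 0"
    and L_le: "real L * (224 * eps) \<le> l * D"
begin

text \<open>
  There are \<open>K\<close> blocks of \<open>L\<close> coordinates.  \<open>P\<close> is the distance that the first and last coordinate of a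
  block must travel, and \<open>A\<close> the decrease of the primal function per block; the factor \<open>1 / 7\<close> makes the
  instance \<open>l\<close>-smooth, \<open>616\<close> makes the decrease in \<open>shift_step\<close> beat the proximal term, and \<open>224\<close>
  does the same in \<open>flattening_step\<close>.
\<close>
definition N :: nat where "N = K * L"
definition P :: real where "P = 616 * eps / l"
definition kap :: real where "kap = l / 7"
definition A :: real where "A = kap * P\<^sup>2 / 2"
definition R :: real where "R = D / 2"

text \<open>
  On a block, \<open>link x = 0\<close> iff \<open>x\<close> is a multiple of \<open>1 / wt\<close>.  The two ends of this vector are larger than its
  interior entries by the factor \<open>sqrt L\<close>, so they carry a constant fraction of its norm although the
  block is long.
\<close>
definition wt :: "nat \<Rightarrow> real" where
  "wt j = (if L dvd j \<or> L dvd Suc j then 1 / sqrt L else 1)"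

definition link :: "(nat \<Rightarrow> real) \<Rightarrow> nat \<Rightarrow> real" where
  "link x j = (if L dvd j then 0 else wt (j - 1) * x (j - 1) - wt j * x j)"

text \<open>Only read at the start of a block, where \<open>j - 1\<close> is the last coordinate of
  the previous block. The first block has no predecessor, so its gate is open.\<close>

definition gate :: "(nat \<Rightarrow> real) \<Rightarrow> nat \<Rightarrow> real" where
  "gate x j = (if j = 0 then 1 else ramp (x (j - 1) / P))"

text \<open>The width \<open>2 * P\<close> is twice that of the gate: a block whose first coordinate
  is still below \<open>P\<close> sits in the lower half of this ramp, where the slope is bounded
  below.\<close>

definition gain :: "(nat \<Rightarrow> real) \<Rightarrow> nat \<Rightarrow> real" where
  "gain x j = (if L dvd j then gate x j * ramp (x j / (2 * P)) else 0)"

definition cell :: "(nat \<Rightarrow> real) \<Rightarrow> (nat \<Rightarrow> real) \<Rightarrow> nat \<Rightarrow> real" where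
  "cell x y j = kap * y j * link x j - A * gain x j"

text \<open>
  Derivatives of \<open>cell x y j\<close> with respect to \<open>x (j - 1)\<close> and \<open>x j\<close>; the former is \<open>0\<close> for \<open>j = 0\<close>, where
  \<open>j - 1\<close> truncates.
\<close>
definition d_prev :: "(nat \<Rightarrow> real) \<Rightarrow> (nat \<Rightarrow> real) \<Rightarrow> nat \<Rightarrow> real" where
  "d_prev x y j =
     (if \<not> L dvd j then kap * wt (j - 1) * y j
      else if j = 0 then 0 else - A * (ramp' (x (j - 1) / P) / P) * ramp (x j / (2 * P)))"

definition d_cur :: "(nat \<Rightarrow> real) \<Rightarrow> (nat \<Rightarrow> real) \<Rightarrow> nat \<Rightarrow> real" where
  "d_cur x y j =
     (if \<not> L dvd j then - kap * wt j * y j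
      else - A * gate x j * (ramp' (x j / (2 * P)) / (2 * P)))"

text \<open>Coordinate \<open>j\<close> of \<open>x\<close> enters cell \<open>j\<close> as current
  and cell \<open>Suc j\<close> as previous coordinate.\<close>

definition grad_x_at :: "(nat \<Rightarrow> real) \<Rightarrow> (nat \<Rightarrow> real) \<Rightarrow> nat \<Rightarrow> real" where
  "grad_x_at x y j = d_cur x y j + (if Suc j < N then d_prev x y (Suc j) else 0)"

section \<open>Bounds, expansions and Lipschitz constants of single cells\<close>

lemma P_pos: "P > 0" and kap_pos: "kap > 0" and A_pos: "A > 0" and R_pos: "R > 0"
  and N_pos: "N > 0"
  using l_pos D_pos eps_pos L_pos K_pos
  by (auto simp: P_def kap_def A_def R_def N_def)

lemma wt_pos: "wt j > 0" and wt_le_1: "wt j \<le> 1"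
  using L_pos by (auto simp: wt_def divide_le_eq)

lemma link_diff: "link x j - link x' j = link (\<lambda>i. x i - x' i) j"
  by (simp add: link_def algebra_simps)

lemma link_le: "\<bar>link x j\<bar> \<le> \<bar>x (j - 1)\<bar> + \<bar>x j\<bar>"
proof (cases "L dvd j")
  case False
  have "\<bar>link x j\<bar> \<le> \<bar>wt (j - 1) * x (j - 1)\<bar> + \<bar>wt j * x j\<bar>"
    using False by (simp add: link_def)
  also have "\<dots> \<le> \<bar>x (j - 1)\<bar> + \<bar>x j\<bar>"
    using wt_pos wt_le_1 by (intro add_mono) (auto simp: abs_mult abs_of_pos mult_le_cancel_right2)
  finally show ?thesis .
qed (simp add: link_def)

lemma gate_nonneg: "x (j - 1) \<ge> 0 \<Longrightarrow> gate x j \<ge> 0"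
  using P_pos by (simp add: gate_def ramp_nonneg)

lemma gate_le_1: "gate x j \<le> 1"
  by (simp add: gate_def ramp_le_1)

lemma gain_le:
  assumes "x (j - 1) \<ge> 0" "x j \<ge> 0"
  shows "gain x j \<le> (if L dvd j then 1 else 0)"
  using assms gate_nonneg[of x j] gate_le_1[of x j] P_pos
  by (auto simp: gain_def ramp_nonneg ramp_le_1 intro!: mult_le_one)

lemma gain_mono:
  assumes "0 \<le> x (j - 1)" "0 \<le> x j" "x (j - 1) \<le> x' (j - 1)" "x j \<le> x' j"
  shows "gain x j \<le> gain x' j"
proof -
  have "gate x j \<le> gate x' j"
    using assms P_pos by (auto simp: gate_def intro!: ramp_mono divide_right_mono)
  moreover have "ramp (x j / (2 * P)) \<le> ramp (x' j / (2 * P))"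
    using assms P_pos by (auto intro!: ramp_mono divide_right_mono)
  ultimately show ?thesis
    using assms P_pos gate_nonneg[of x' j] by (auto simp: gain_def ramp_nonneg intro!: mult_mono)
qed

text \<open>Inside a block the cell is bilinear, so the error is the cross term of the increments of
  \<open>y j\<close> and the link. At the start of a block it is \<open>A\<close> times a ramp
  remainder, and \<open>A = kap * P\<^sup>2 / 2\<close> cancels the squared ramp widths.\<close>

lemma cell_taylor:
  assumes "x (j - 1) \<ge> 0" "x j \<ge> 0" "x' (j - 1) \<ge> 0" "x' j \<ge> 0"
  shows "\<bar>cell x' y' j - cell x y j - d_prev x y j * (x' (j - 1) - x (j - 1))
      - d_cur x y j * (x' j - x j) - kap * link x j * (y' j - y j)\<bar>
    \<le> 2 * kap * ((x' (j - 1) - x (j - 1))\<^sup>2 + (x' j - x j)\<^sup>2 + (y' j - y j)\<^sup>2)"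
    (is "\<bar>?lhs\<bar> \<le> ?rhs")
proof -
  define b c e where "b = x' (j - 1) - x (j - 1)" and "c = x' j - x j" and "e = y' j - y j"
  have rhs: "?rhs = 2 * kap * (b\<^sup>2 + c\<^sup>2 + e\<^sup>2)"
    by (simp add: b_def c_def e_def)
  show ?thesis
  proof (cases "L dvd j")
    case False
    have "?lhs = kap * (e * (link x' j - link x j))"
      using False by (simp add: cell_def d_prev_def d_cur_def gain_def link_def e_def algebra_simps)
    then have "\<bar>?lhs\<bar> = kap * (\<bar>e\<bar> * \<bar>link x' j - link x j\<bar>)"
      using kap_pos by (simp add: abs_mult)
    also have "\<dots> \<le> kap * (\<bar>e\<bar> * (\<bar>b\<bar> + \<bar>c\<bar>))"
      using link_le[of "\<lambda>i. x' i - x i" j] kap_pos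
      by (intro mult_left_mono) (auto simp: link_diff b_def c_def)
    also have "\<dots> \<le> kap * (2 * (b\<^sup>2 + c\<^sup>2 + e\<^sup>2))"
    proof (intro mult_left_mono)
      have "2 * (\<bar>e\<bar> * \<bar>b\<bar>) \<le> e\<^sup>2 + b\<^sup>2" "2 * (\<bar>e\<bar> * \<bar>c\<bar>) \<le> e\<^sup>2 + c\<^sup>2"
        using sum_squares_bound[of "\<bar>e\<bar>" "\<bar>b\<bar>"] sum_squares_bound[of "\<bar>e\<bar>" "\<bar>c\<bar>"] by simp_all
      then show "\<bar>e\<bar> * (\<bar>b\<bar> + \<bar>c\<bar>) \<le> 2 * (b\<^sup>2 + c\<^sup>2 + e\<^sup>2)"
        using zero_le_power2[of b] zero_le_power2[of c] zero_le_power2[of e]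
        unfolding distrib_left by linarith
    qed (use kap_pos in simp)
    finally show ?thesis unfolding rhs by (simp only: mult_ac)
  next
    case True
    show ?thesis
    proof (cases "j = 0")
      case [simp]: True
      have "?lhs = - (A * (ramp (x' 0 / (2*P)) - ramp (x 0 / (2*P)) - ramp' (x 0 / (2*P)) * (x' 0 / (2*P) - x 0 / (2*P))))"
        using P_pos by (simp add: cell_def d_prev_def d_cur_def gain_def link_def gate_def field_simps)
      then have "\<bar>?lhs\<bar> = A * \<bar>ramp (x' 0 / (2*P)) - ramp (x 0 / (2*P)) - ramp' (x 0 / (2*P)) * (x' 0 / (2*P) - x 0 / (2*P))\<bar>"
        using A_pos by (simp only: abs_minus_cancel abs_mult abs_of_pos divide_pos_pos mult_pos_pos zero_less_numeral)
      also have "\<dots> \<le> A * (x' 0 / (2*P) - x 0 / (2*P))\<^sup>2"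
        using A_pos by (intro mult_left_mono ramp_taylor) simp
      also have "\<dots> = kap * c\<^sup>2 / 8"
        using P_pos by (simp add: A_def c_def field_simps power2_eq_square)
      also have "\<dots> \<le> ?rhs"
        using kap_pos unfolding rhs by (simp add: algebra_simps)
      finally show ?thesis .
    next
      case False
      let ?a = "x (j - 1) / P" and ?b = "x j / (2*P)" and ?a' = "x' (j - 1) / P" and ?b' = "x' j / (2*P)"
      let ?t = "ramp ?a' * ramp ?b' - ramp ?a * ramp ?b - ramp' ?a * ramp ?b * (?a' - ?a) - ramp ?a * ramp' ?b * (?b' - ?b)"
      have "?lhs = - (A * ?t)"
        using P_pos True False
        by (simp add: cell_def d_prev_def d_cur_def gain_def link_def gate_def field_simps)
      then have "\<bar>?lhs\<bar> = A * \<bar>?t\<bar>"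
        using A_pos by (simp only: abs_minus_cancel abs_mult abs_of_pos divide_pos_pos mult_pos_pos zero_less_numeral)
      also have "\<dots> \<le> A * (3 * (?a' - ?a)\<^sup>2 + 3 * (?b' - ?b)\<^sup>2)"
        using A_pos assms P_pos by (intro mult_left_mono ramp_product_taylor) auto
      also have "\<dots> = kap * (3 / 2 * b\<^sup>2 + 3 / 8 * c\<^sup>2)"
        using P_pos by (simp add: A_def b_def c_def field_simps power2_eq_square)
      also have "\<dots> \<le> kap * (2 * (b\<^sup>2 + c\<^sup>2 + e\<^sup>2))"
        using kap_pos zero_le_power2[of b] zero_le_power2[of c] zero_le_power2[of e]
        by (intro mult_left_mono) argo+
      finally show ?thesis unfolding rhs by (simp only: mult_ac)
    qed
  qed
qed

text \<open>At the start of a block, the two factors of the derivative are varied one at a time.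
  This gives the constant \<open>2 / P\<close>, which the factor \<open>A / P\<close> turns into
  exactly \<open>kap\<close>.\<close>

lemma d_prev_lipschitz:
  assumes "x (j - 1) \<ge> 0" "x j \<ge> 0" "x' (j - 1) \<ge> 0" "x' j \<ge> 0"
  shows "\<bar>d_prev x y j - d_prev x' y' j\<bar>
    \<le> kap * (\<bar>x (j - 1) - x' (j - 1)\<bar> + \<bar>x j - x' j\<bar> + \<bar>y j - y' j\<bar>)"
proof (cases "L dvd j")
  case False
  have "\<bar>d_prev x y j - d_prev x' y' j\<bar> = kap * (wt (j - 1) * \<bar>y j - y' j\<bar>)"
    using False kap_pos wt_pos[of "j - 1"]
    by (simp add: d_prev_def abs_mult flip: right_diff_distrib)
  also have "\<dots> \<le> kap * (1 * \<bar>y j - y' j\<bar>)"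
    using kap_pos wt_le_1 by (intro mult_left_mono mult_right_mono) auto
  also have "\<dots> \<le> kap * (\<bar>x (j - 1) - x' (j - 1)\<bar> + \<bar>x j - x' j\<bar> + \<bar>y j - y' j\<bar>)"
    using kap_pos by (intro mult_left_mono) auto
  finally show ?thesis .
next
  case True
  let ?a = "x (j - 1) / P" and ?b = "x j / (2*P)" and ?a' = "x' (j - 1) / P" and ?b' = "x' j / (2*P)"
  have "\<bar>ramp' ?a * ramp ?b - ramp' ?a' * ramp ?b'\<bar>
      = \<bar>(ramp' ?a - ramp' ?a') * ramp ?b + ramp' ?a' * (ramp ?b - ramp ?b')\<bar>"
    by (simp add: algebra_simps)
  also have "\<dots> \<le> \<bar>ramp' ?a - ramp' ?a'\<bar> * \<bar>ramp ?b\<bar> + \<bar>ramp' ?a'\<bar> * \<bar>ramp ?b - ramp ?b'\<bar>"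
    by (intro order_trans[OF abs_triangle_ineq]) (simp add: abs_mult)
  also have "\<dots> \<le> (2 * \<bar>?a - ?a'\<bar>) * 1 + 2 * (2 * \<bar>?b - ?b'\<bar>)"
    using assms P_pos
    by (intro add_mono mult_mono ramp'_lipschitz ramp_lipschitz)
      (auto simp: ramp_nonneg ramp_le_1 ramp'_nonneg ramp'_le)
  also have "\<dots> = 2 / P * (\<bar>x (j - 1) - x' (j - 1)\<bar> + \<bar>x j - x' j\<bar>)"
    using P_pos by (simp add: abs_divide field_simps flip: diff_divide_distrib)
  finally have le: "\<bar>ramp' ?a * ramp ?b - ramp' ?a' * ramp ?b'\<bar> \<le> \<dots>" .
  show ?thesis
  proof (cases "j = 0")
    case False
    have "d_prev x y j - d_prev x' y' j = - (A / P * (ramp' ?a * ramp ?b - ramp' ?a' * ramp ?b'))"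
      using True False by (simp add: d_prev_def algebra_simps diff_divide_distrib)
    then have "\<bar>d_prev x y j - d_prev x' y' j\<bar> = A / P * \<bar>ramp' ?a * ramp ?b - ramp' ?a' * ramp ?b'\<bar>"
      using A_pos P_pos by (simp only: abs_minus_cancel abs_mult abs_of_pos divide_pos_pos mult_pos_pos zero_less_numeral)
    also have "\<dots> \<le> A / P * (2 / P * (\<bar>x (j - 1) - x' (j - 1)\<bar> + \<bar>x j - x' j\<bar>))"
      using A_pos P_pos by (intro mult_left_mono le) auto
    also have "\<dots> = kap * (\<bar>x (j - 1) - x' (j - 1)\<bar> + \<bar>x j - x' j\<bar>)"
      using P_pos by (simp add: A_def field_simps power2_eq_square)
    also have "\<dots> \<le> kap * (\<bar>x (j - 1) - x' (j - 1)\<bar> + \<bar>x j - x' j\<bar> + \<bar>y j - y' j\<bar>)"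
      using kap_pos by (intro mult_left_mono) auto
    finally show ?thesis .
  qed (use kap_pos in \<open>simp add: d_prev_def\<close>)
qed

lemma gate_lipschitz:
  assumes "x (j - 1) \<ge> 0" "x' (j - 1) \<ge> 0"
  shows "\<bar>gate x j - gate x' j\<bar> \<le> 2 * \<bar>x (j - 1) - x' (j - 1)\<bar> / P"
  using ramp_lipschitz[of "x (j - 1) / P" "x' (j - 1) / P"] assms P_pos
  by (simp add: gate_def abs_divide flip: diff_divide_distrib)

lemma d_cur_lipschitz:
  assumes "x (j - 1) \<ge> 0" "x j \<ge> 0" "x' (j - 1) \<ge> 0" "x' j \<ge> 0"
  shows "\<bar>d_cur x y j - d_cur x' y' j\<bar>
    \<le> kap * (\<bar>x (j - 1) - x' (j - 1)\<bar> + \<bar>x j - x' j\<bar> + \<bar>y j - y' j\<bar>)"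
proof (cases "L dvd j")
  case False
  then have "d_cur x y j - d_cur x' y' j = - (kap * (wt j * (y j - y' j)))"
    by (simp add: d_cur_def algebra_simps)
  then have "\<bar>d_cur x y j - d_cur x' y' j\<bar> = kap * (wt j * \<bar>y j - y' j\<bar>)"
    using kap_pos wt_pos[of j] by (simp add: abs_mult)
  also have "\<dots> \<le> kap * (1 * \<bar>y j - y' j\<bar>)"
    using kap_pos wt_le_1 by (intro mult_left_mono mult_right_mono) auto
  also have "\<dots> \<le> kap * (\<bar>x (j - 1) - x' (j - 1)\<bar> + \<bar>x j - x' j\<bar> + \<bar>y j - y' j\<bar>)"
    using kap_pos by (intro mult_left_mono) auto
  finally show ?thesis .
next
  case True
  let ?b = "x j / (2*P)" and ?b' = "x' j / (2*P)"
  have "\<bar>gate x j * ramp' ?b - gate x' j * ramp' ?b'\<bar>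
      = \<bar>(gate x j - gate x' j) * ramp' ?b + gate x' j * (ramp' ?b - ramp' ?b')\<bar>"
    by (simp add: algebra_simps)
  also have "\<dots> \<le> \<bar>gate x j - gate x' j\<bar> * \<bar>ramp' ?b\<bar> + \<bar>gate x' j\<bar> * \<bar>ramp' ?b - ramp' ?b'\<bar>"
    by (intro order_trans[OF abs_triangle_ineq]) (simp add: abs_mult)
  also have "\<dots> \<le> (2 * \<bar>x (j - 1) - x' (j - 1)\<bar> / P) * 2 + 1 * (2 * \<bar>?b - ?b'\<bar>)"
    using assms P_pos
    by (intro add_mono mult_mono ramp'_lipschitz gate_lipschitz)
      (auto simp: ramp'_nonneg ramp'_le gate_nonneg gate_le_1)
  \<comment> \<open>The coefficients are \<open>4 / P\<close> and \<open>1 / P\<close>; rounding the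
    second up suffices, because \<open>A / (2 * P)\<close> times \<open>4 / P\<close> is
    \<open>kap\<close>.\<close>
  also have "\<dots> \<le> 4 / P * (\<bar>x (j - 1) - x' (j - 1)\<bar> + \<bar>x j - x' j\<bar>)"
    using P_pos by (simp add: abs_divide field_simps flip: diff_divide_distrib)
  finally have le: "\<bar>gate x j * ramp' ?b - gate x' j * ramp' ?b'\<bar> \<le> \<dots>" .
  have "d_cur x y j - d_cur x' y' j = - (A / (2 * P) * (gate x j * ramp' ?b - gate x' j * ramp' ?b'))"
    using True by (simp add: d_cur_def algebra_simps diff_divide_distrib)
  then have "\<bar>d_cur x y j - d_cur x' y' j\<bar> = A / (2 * P) * \<bar>gate x j * ramp' ?b - gate x' j * ramp' ?b'\<bar>"
    using A_pos P_pos by (simp only: abs_minus_cancel abs_mult abs_of_pos divide_pos_pos mult_pos_pos zero_less_numeral)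
  also have "\<dots> \<le> A / (2 * P) * (4 / P * (\<bar>x (j - 1) - x' (j - 1)\<bar> + \<bar>x j - x' j\<bar>))"
    using A_pos P_pos by (intro mult_left_mono le) auto
  also have "\<dots> = kap * (\<bar>x (j - 1) - x' (j - 1)\<bar> + \<bar>x j - x' j\<bar>)"
    using P_pos by (simp add: A_def field_simps power2_eq_square)
  also have "\<dots> \<le> kap * (\<bar>x (j - 1) - x' (j - 1)\<bar> + \<bar>x j - x' j\<bar> + \<bar>y j - y' j\<bar>)"
    using kap_pos by (intro mult_left_mono) auto
  finally show ?thesis .
qed

text \<open>Summing the cell errors counts each coordinate of \<open>x\<close> as current and,
  through the shifted index, up to twice as previous; this turns \<open>2 * kap\<close> into
  \<open>6 * kap\<close>.\<close>

lemma sum_cell_taylor: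
  assumes x: "\<And>j. j < N \<Longrightarrow> x j \<ge> 0" and x': "\<And>j. j < N \<Longrightarrow> x' j \<ge> 0"
  shows "\<bar>(\<Sum>j<N. cell x' y' j) - (\<Sum>j<N. cell x y j) - (\<Sum>j<N. grad_x_at x y j * (x' j - x j))
      - (\<Sum>j<N. kap * link x j * (y' j - y j))\<bar>
    \<le> 6 * kap * ((\<Sum>j<N. (x' j - x j)\<^sup>2) + (\<Sum>j<N. (y' j - y j)\<^sup>2))"
proof -
  have "(\<Sum>j<N. grad_x_at x y j * (x' j - x j))
      = (\<Sum>j<N. d_cur x y j * (x' j - x j))
        + (\<Sum>j<N. if Suc j < N then d_prev x y (Suc j) * (x' (Suc j - 1) - x (Suc j - 1)) else 0)"
    unfolding sum.distrib[symmetric]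
    by (intro sum.cong) (auto simp: grad_x_at_def algebra_simps)
  \<comment> \<open>The shift loses nothing because \<open>d_prev x y 0 = 0\<close>.\<close>
  also have "(\<Sum>j<N. if Suc j < N then d_prev x y (Suc j) * (x' (Suc j - 1) - x (Suc j - 1)) else 0)
      = (\<Sum>j<N. d_prev x y j * (x' (j - 1) - x (j - 1)))"
    by (rule sum_lessThan_if_Suc) (simp add: d_prev_def)
  finally have eq: "(\<Sum>j<N. cell x' y' j) - (\<Sum>j<N. cell x y j)
      - (\<Sum>j<N. grad_x_at x y j * (x' j - x j)) - (\<Sum>j<N. kap * link x j * (y' j - y j))
    = (\<Sum>j<N. cell x' y' j - cell x y j - d_prev x y j * (x' (j - 1) - x (j - 1))
      - d_cur x y j * (x' j - x j) - kap * link x j * (y' j - y j))"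
    by (simp add: sum_subtractf)
  have "\<bar>\<dots>\<bar> \<le> (\<Sum>j<N. 2 * kap * ((x' (j - 1) - x (j - 1))\<^sup>2 + (x' j - x j)\<^sup>2 + (y' j - y j)\<^sup>2))"
    using x x' by (intro order_trans[OF sum_abs] sum_mono cell_taylor) auto
  also have "\<dots> = 2 * kap * ((\<Sum>j<N. (x' (j - 1) - x (j - 1))\<^sup>2) + (\<Sum>j<N. (x' j - x j)\<^sup>2)
      + (\<Sum>j<N. (y' j - y j)\<^sup>2))"
    by (simp add: sum.distrib flip: sum_distrib_left)
  also have "\<dots> \<le> 2 * kap * (3 * ((\<Sum>j<N. (x' j - x j)\<^sup>2) + (\<Sum>j<N. (y' j - y j)\<^sup>2)))"
    using sum_lessThan_pred[of N "\<lambda>j. (x' j - x j)\<^sup>2"] kap_pos sum_nonneg[of "{..<N}" "\<lambda>j. (y' j - y j)\<^sup>2"]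
    by (intro mult_left_mono) auto
  also have "\<dots> = 6 * kap * ((\<Sum>j<N. (x' j - x j)\<^sup>2) + (\<Sum>j<N. (y' j - y j)\<^sup>2))"
    by simp
  finally show ?thesis unfolding eq .
qed

text \<open>The current and previous parts cost 2 + 2 copies of the sum of
  \<open>(S j)\<^sup>2\<close> and the links one more. Squaring three terms costs 3, and the shifted
  index raises the \<open>x\<close> share to 9. In total 5 * 9 = 45 is below 49, which is why
  \<open>kap\<close> is \<open>l / 7\<close>.\<close>

lemma gradient_lipschitz:
  assumes x: "\<And>j. j < N \<Longrightarrow> x j \<ge> 0" and x': "\<And>j. j < N \<Longrightarrow> x' j \<ge> 0"
  shows "(\<Sum>j<N. (grad_x_at x y j - grad_x_at x' y' j)\<^sup>2) + (\<Sum>j<N. (kap * link x j - kap * link x' j)\<^sup>2)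
    \<le> l\<^sup>2 * ((\<Sum>j<N. (x j - x' j)\<^sup>2) + (\<Sum>j<N. (y j - y' j)\<^sup>2))"
proof -
  define S where "S j = kap * (\<bar>x (j - 1) - x' (j - 1)\<bar> + \<bar>x j - x' j\<bar> + \<bar>y j - y' j\<bar>)" for j
  have cur: "(d_cur x y j - d_cur x' y' j)\<^sup>2 \<le> (S j)\<^sup>2" if "j < N" for j
    using d_cur_lipschitz[of x j x' y y'] x x' that
    by (intro iffD1[OF abs_le_square_iff] order_trans[OF _ abs_ge_self]) (auto simp: S_def)
  have prev: "(d_prev x y j - d_prev x' y' j)\<^sup>2 \<le> (S j)\<^sup>2" if "j < N" for j
    using d_prev_lipschitz[of x j x' y y'] x x' that
    by (intro iffD1[OF abs_le_square_iff] order_trans[OF _ abs_ge_self]) (auto simp: S_def)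
  have lk: "(kap * link x j - kap * link x' j)\<^sup>2 \<le> (S j)\<^sup>2" for j
  proof -
    have "\<bar>kap * link x j - kap * link x' j\<bar> = kap * \<bar>link (\<lambda>i. x i - x' i) j\<bar>"
      using kap_pos by (simp add: abs_mult flip: right_diff_distrib link_diff)
    also have "\<dots> \<le> S j"
      using link_le[of "\<lambda>i. x i - x' i" j] kap_pos unfolding S_def
      by (intro mult_left_mono) linarith+
    finally show ?thesis by (auto simp: abs_le_square_iff[symmetric])
  qed
  have "(\<Sum>j<N. (grad_x_at x y j - grad_x_at x' y' j)\<^sup>2)
      \<le> (\<Sum>j<N. 2 * (S j)\<^sup>2 + 2 * (if Suc j < N then (d_prev x y (Suc j) - d_prev x' y' (Suc j))\<^sup>2 else 0))"
  proof (intro sum_mono)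
    fix j assume j: "j \<in> {..<N}"
    have "(grad_x_at x y j - grad_x_at x' y' j)\<^sup>2
        = ((d_cur x y j - d_cur x' y' j) + (if Suc j < N then d_prev x y (Suc j) - d_prev x' y' (Suc j) else 0))\<^sup>2"
      by (simp add: grad_x_at_def algebra_simps)
    also have "\<dots> \<le> 2 * (d_cur x y j - d_cur x' y' j)\<^sup>2
        + 2 * (if Suc j < N then d_prev x y (Suc j) - d_prev x' y' (Suc j) else 0)\<^sup>2"
      by (rule square_sum2_le)
    finally show "(grad_x_at x y j - grad_x_at x' y' j)\<^sup>2 \<le> 2 * (S j)\<^sup>2
        + 2 * (if Suc j < N then (d_prev x y (Suc j) - d_prev x' y' (Suc j))\<^sup>2 else 0)"
      using cur[of j] j by (auto split: if_splits)
  qed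
  also have "\<dots> = 2 * (\<Sum>j<N. (S j)\<^sup>2) + 2 * (\<Sum>j<N. (d_prev x y j - d_prev x' y' j)\<^sup>2)"
    using sum_lessThan_if_Suc[of "\<lambda>j. (d_prev x y j - d_prev x' y' j)\<^sup>2" N]
    by (simp add: sum.distrib d_prev_def flip: sum_distrib_left)
  also have "\<dots> \<le> 2 * (\<Sum>j<N. (S j)\<^sup>2) + 2 * (\<Sum>j<N. (S j)\<^sup>2)"
    using prev by (intro add_mono mult_left_mono sum_mono) auto
  finally have "(\<Sum>j<N. (grad_x_at x y j - grad_x_at x' y' j)\<^sup>2) + (\<Sum>j<N. (kap * link x j - kap * link x' j)\<^sup>2)
      \<le> 5 * (\<Sum>j<N. (S j)\<^sup>2)"
    using sum_mono[of "{..<N}" "\<lambda>j. (kap * link x j - kap * link x' j)\<^sup>2" "\<lambda>j. (S j)\<^sup>2"] lk by simp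
  also have "(\<Sum>j<N. (S j)\<^sup>2)
      \<le> (\<Sum>j<N. kap\<^sup>2 * (3 * (x (j - 1) - x' (j - 1))\<^sup>2 + 3 * (x j - x' j)\<^sup>2 + 3 * (y j - y' j)\<^sup>2))"
    unfolding S_def power_mult_distrib
    by (intro sum_mono mult_left_mono order_trans[OF square_sum3_le]) auto
  also have "\<dots> = kap\<^sup>2 * (3 * (\<Sum>j<N. (x (j - 1) - x' (j - 1))\<^sup>2) + 3 * (\<Sum>j<N. (x j - x' j)\<^sup>2)
      + 3 * (\<Sum>j<N. (y j - y' j)\<^sup>2))"
    by (simp add: sum.distrib flip: sum_distrib_left)
  also have "\<dots> \<le> kap\<^sup>2 * (9 * ((\<Sum>j<N. (x j - x' j)\<^sup>2) + (\<Sum>j<N. (y j - y' j)\<^sup>2)))"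
    using sum_lessThan_pred[of N "\<lambda>j. (x j - x' j)\<^sup>2"] sum_nonneg[of "{..<N}" "\<lambda>j. (y j - y' j)\<^sup>2"]
    by (intro mult_left_mono) auto
  also have "5 * \<dots> = 45 / 49 * (l\<^sup>2 * ((\<Sum>j<N. (x j - x' j)\<^sup>2) + (\<Sum>j<N. (y j - y' j)\<^sup>2)))"
    by (simp add: kap_def power_divide)
  also have "\<dots> \<le> 1 * (l\<^sup>2 * ((\<Sum>j<N. (x j - x' j)\<^sup>2) + (\<Sum>j<N. (y j - y' j)\<^sup>2)))"
    by (intro mult_right_mono mult_nonneg_nonneg add_nonneg_nonneg sum_nonneg) auto
  finally show ?thesis by simp
qed

subsection \<open>Descent for the proximal objective\<close>

text \<open>The primal function: the maximum over the ball of radius \<open>R\<close> turns the bilinear term into a norm.\<close>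
definition val :: "(nat \<Rightarrow> real) \<Rightarrow> real" where
  "val x = kap * R * L2_set (link x) {..<N} - A * (\<Sum>j<N. gain x j)"

section \<open>Arithmetic of blocks and flattening of a point\<close>

lemma block_less_N: "b < K \<Longrightarrow> i < L \<Longrightarrow> b * L + i < N"
  using mult_le_mono1[of "Suc b" K L] by (simp add: N_def)

lemma block_subset: "b < K \<Longrightarrow> {b * L..<b * L + L} \<subseteq> {..<N}"
  using mult_le_mono1[of "Suc b" K L] by (auto simp: N_def)

lemma in_block: "j \<in> {j div L * L..<j div L * L + L}"
  using div_mult_mod_eq[of j L] mod_less_divisor[OF L_pos, of j]
  unfolding atLeastLessThan_iff by linarith

lemma block_div: "j \<in> {b * L..<b * L + L} \<Longrightarrow> j div L = b"
  by (rule div_nat_eqI) (auto simp: mult.commute)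

lemma pred_div_L: "\<not> L dvd j \<Longrightarrow> (j - 1) div L = j div L"
  using div_Suc[of "j - 1" L] by (cases j) (auto simp: dvd_eq_mod_eq_0)

lemma sum_blocks: "(\<Sum>b<K. \<Sum>j\<in>{b * L..<b * L + L}. f j) = (\<Sum>j<N. f j)" for f :: "nat \<Rightarrow> real"
  unfolding N_def by (rule sum.nat_group)

text \<open>The base value 1 summed over the block and each of the two ends contribute at most
  \<open>L\<close>; for \<open>L = 1\<close> the ends coincide and the bound still holds.\<close>

lemma sum_inverse_wt_block: "(\<Sum>j\<in>{b * L..<b * L + L}. (1 / wt j)\<^sup>2) \<le> 3 * real L"
proof -
  have first: "L dvd j \<longleftrightarrow> j = b * L" and last: "L dvd Suc j \<longleftrightarrow> j = b * L + L - 1"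
    if "j \<in> {b * L..<b * L + L}" for j
  proof -
    define i where "i = j - b * L"
    have i: "j = b * L + i" "i < L"
      using that by (auto simp: i_def)
    have "L dvd j \<longleftrightarrow> L dvd i"
      unfolding i by (rule dvd_add_right_iff) simp
    also have "\<dots> \<longleftrightarrow> i = 0"
      using i(2) nat_dvd_not_less[of i L] by (cases "i = 0") simp_all
    finally show "L dvd j \<longleftrightarrow> j = b * L"
      using i by simp
    have "L dvd Suc j \<longleftrightarrow> L dvd Suc i"
      unfolding i add_Suc_right[symmetric] by (rule dvd_add_right_iff) simp
    also have "\<dots> \<longleftrightarrow> Suc i = L"
      using i(2) nat_dvd_not_less[of "Suc i" L] by (cases "Suc i = L") simp_all
    finally show "L dvd Suc j \<longleftrightarrow> j = b * L + L - 1"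
      using i by auto
  qed
  have "(\<Sum>j\<in>{b * L..<b * L + L}. (1 / wt j)\<^sup>2)
      \<le> (\<Sum>j\<in>{b * L..<b * L + L}. 1 + (if j = b * L then real L else 0) + (if j = b * L + L - 1 then real L else 0))"
    by (intro sum_mono) (auto simp: wt_def first last)
  also have "\<dots> = 3 * real L"
    using L_pos by (simp add: sum.distrib)
  finally show ?thesis .
qed

text \<open>
  Any common value of \<open>wt j * (x j + w j)\<close> over a block removes the links; one that dominates all
  \<open>wt j * x j\<close> of the block keeps \<open>w\<close> nonnegative, so that \<open>gain\<close> cannot decrease.
\<close>
lemma flattening_direction:
  assumes x: "\<And>j. j < N \<Longrightarrow> x j \<ge> 0"
  obtains w m where "\<And>j. j < N \<Longrightarrow> w j \<ge> 0" "\<And>j. j < N \<Longrightarrow> link w j = - link x j"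
    "L2_set w {..<N} \<le> 4 * real L * L2_set (link x) {..<N}"
    "\<And>j. j < N \<Longrightarrow> wt j * (x j + w j) = m (j div L)"
proof
  define p where "p j = wt j * x j" for j
  define S where "S b = (\<Sum>j\<in>{b * L..<b * L + L}. \<bar>link x j\<bar>)" for b
  define m where "m b = p (b * L) + S b" for b
  define w where "w j = (m (j div L) - p j) / wt j" for j
  \<comment> \<open>Links are differences of consecutive weighted values, so they telescope; the
    link at the block start is 0 by definition.\<close>
  have partial: "\<bar>p (b * L + i) - p (b * L)\<bar> \<le> (\<Sum>j\<in>{b * L..<b * L + Suc i}. \<bar>link x j\<bar>)" if "i < L" for b i
    using that
  proof (induction i)
    case (Suc i)
    have "\<not> L dvd b * L + Suc i"
      using nat_dvd_not_less[of "Suc i" L] Suc.prems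
      by (subst dvd_add_right_iff) auto
    then have "link x (b * L + Suc i) = p (b * L + i) - p (b * L + Suc i)"
      by (simp add: link_def p_def)
    then show ?case
      using Suc by simp
  qed simp
  have close: "\<bar>p j - p (j div L * L)\<bar> \<le> S (j div L)" for j
  proof -
    let ?b = "j div L" and ?i = "j mod L"
    have "?i < L" using L_pos by simp
    have "\<bar>p (?b * L + ?i) - p (?b * L)\<bar> \<le> (\<Sum>j\<in>{?b * L..<?b * L + Suc ?i}. \<bar>link x j\<bar>)"
      using \<open>?i < L\<close> by (rule partial)
    also have "\<dots> \<le> S ?b"
      unfolding S_def using \<open>?i < L\<close> in_block[of j] by (intro sum_mono2) auto
    finally show ?thesis by simp
  qed
  have S2: "(S b)\<^sup>2 \<le> real L * (\<Sum>j\<in>{b * L..<b * L + L}. (link x j)\<^sup>2)" for b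
    using sum_squared_le_sum_of_squares[of "\<lambda>j. \<bar>link x j\<bar>" "{b * L..<b * L + L}"]
    by (simp add: S_def mult.commute)
  show w_nonneg: "w j \<ge> 0" for j
    using close[of j] wt_pos[of j] by (simp add: w_def m_def)
  show flat: "wt j * (x j + w j) = m (j div L)" for j
    using wt_pos[of j] by (simp add: w_def p_def field_simps)
  show "link w j = - link x j" for j
  proof (cases "L dvd j")
    case False
    have "wt (j - 1) * (x (j - 1) + w (j - 1)) = wt j * (x j + w j)"
      by (simp only: flat pred_div_L[OF False])
    then show ?thesis using False by (simp add: link_def algebra_simps)
  qed (simp add: link_def)
  have w2: "(w j)\<^sup>2 \<le> 4 * (S (j div L))\<^sup>2 * (1 / wt j)\<^sup>2" for j
  proof -
    have "0 \<le> m (j div L) - p j" "m (j div L) - p j \<le> 2 * S (j div L)"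
      using close[of j] by (auto simp: m_def)
    then have "(m (j div L) - p j)\<^sup>2 \<le> (2 * S (j div L))\<^sup>2"
      by (rule power_mono[rotated])
    then show ?thesis
      by (simp add: w_def power_divide power_mult_distrib divide_right_mono)
  qed
  have "(\<Sum>j<N. (w j)\<^sup>2) \<le> (\<Sum>j<N. 4 * (S (j div L))\<^sup>2 * (1 / wt j)\<^sup>2)"
    by (intro sum_mono w2)
  also have "\<dots> = (\<Sum>b<K. \<Sum>j\<in>{b * L..<b * L + L}. 4 * (S (j div L))\<^sup>2 * (1 / wt j)\<^sup>2)"
    by (rule sum_blocks[symmetric])
  also have "\<dots> = (\<Sum>b<K. 4 * (S b)\<^sup>2 * (\<Sum>j\<in>{b * L..<b * L + L}. (1 / wt j)\<^sup>2))"
    unfolding sum_distrib_left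
    by (intro sum.cong refl, subst block_div, assumption) (simp add: mult_ac)
  \<comment> \<open>Cauchy-Schwarz on the links of a block gives one factor \<open>L\<close>, the
    weights give \<open>3 * L\<close>. The constant 12 is later rounded up to the square 16.\<close>
  also have "\<dots> \<le> (\<Sum>b<K. 4 * (real L * (\<Sum>j\<in>{b * L..<b * L + L}. (link x j)\<^sup>2)) * (3 * real L))"
    using S2 sum_inverse_wt_block
    by (intro sum_mono mult_mono) (auto intro!: sum_nonneg mult_nonneg_nonneg)
  also have "\<dots> = 12 * (real L)\<^sup>2 * (\<Sum>j<N. (link x j)\<^sup>2)"
    unfolding sum_blocks[symmetric, of "\<lambda>j. (link x j)\<^sup>2"] 
      sum_distrib_left[where r = "12 * (real L)\<^sup>2" and A = "{..<K}"]
    by (intro sum.cong refl) (simp add: power2_eq_square)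
  also have "\<dots> \<le> 16 * (real L)\<^sup>2 * (\<Sum>j<N. (link x j)\<^sup>2)"
    by (intro mult_right_mono sum_nonneg) auto
  finally have "L2_set w {..<N} \<le> sqrt (16 * (real L)\<^sup>2 * (\<Sum>j<N. (link x j)\<^sup>2))"
    unfolding L2_set_def by (rule real_sqrt_le_mono)
  then show "L2_set w {..<N} \<le> 4 * real L * L2_set (link x) {..<N}"
    by (simp add: L2_set_def real_sqrt_mult)
qed

text \<open>A step of relative length \<open>t\<close> scales every link by \<open>1 - t\<close> and
  cannot lower \<open>gain\<close>, so \<open>val\<close> falls by at least
  \<open>4 * eps * t * n\<close> with \<open>n\<close> the norm of \<open>w\<close>. The proximal
  term rises by at most \<open>3 * eps * t * n\<close>, as both the distance to \<open>c\<close> and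
  the step are at most \<open>eps / l\<close>.\<close>

lemma flattening_step:
  assumes z: "\<And>j. j < N \<Longrightarrow> z j \<ge> 0" and zc: "L2_set (\<lambda>j. z j - c j) {..<N} \<le> eps / l"
    and w: "\<And>j. j < N \<Longrightarrow> w j \<ge> 0" and lw: "\<And>j. j < N \<Longrightarrow> link w j = - link z j"
    and nw: "L2_set w {..<N} \<le> 4 * real L * L2_set (link z) {..<N}"
    and t: "0 \<le> t" "t \<le> 1" "t * L2_set w {..<N} \<le> eps / l"
  shows "val (\<lambda>j. z j + t * w j) + l * (L2_set (\<lambda>j. z j + t * w j - c j) {..<N})\<^sup>2
    \<le> val z + l * (L2_set (\<lambda>j. z j - c j) {..<N})\<^sup>2 - t * L2_set w {..<N} * eps"
proof -
  define n where "n = L2_set w {..<N}"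
  define q where "q = L2_set (\<lambda>j. z j - c j) {..<N}"
  define k where "k = L2_set (link z) {..<N}"
  have nonneg: "n \<ge> 0" "q \<ge> 0" "k \<ge> 0" by (auto simp: n_def q_def k_def)
  have "link (\<lambda>j. z j + t * w j) j = (1 - t) * link z j" if "j < N" for j
  proof -
    have "link (\<lambda>j. z j + t * w j) j = link z j + t * link w j"
      by (simp add: link_def algebra_simps)
    then show ?thesis using lw[OF that] by (simp add: algebra_simps)
  qed
  then have "L2_set (link (\<lambda>j. z j + t * w j)) {..<N} = L2_set (\<lambda>j. (1 - t) * link z j) {..<N}"
    by (intro L2_set_cong) auto
  also have "\<dots> = (1 - t) * k"
    using t by (simp add: L2_set_right_distrib k_def)
  finally have lk: "L2_set (link (\<lambda>j. z j + t * w j)) {..<N} = (1 - t) * k" .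
  have "(\<Sum>j<N. gain z j) \<le> (\<Sum>j<N. gain (\<lambda>j. z j + t * w j) j)"
    using z w t by (intro sum_mono gain_mono) auto
  then have "A * (\<Sum>j<N. gain z j) \<le> A * (\<Sum>j<N. gain (\<lambda>j. z j + t * w j) j)"
    using A_pos by (intro mult_left_mono) auto
  then have val: "val (\<lambda>j. z j + t * w j) \<le> val z - t * (kap * R * k)"
    unfolding val_def lk by (simp add: k_def[symmetric] algebra_simps)
  \<comment> \<open>The bound on \<open>w\<close> gives 16 \<open>eps\<close> \<open>L\<close>
    \<open>k\<close>; since 16 = 224 / 14 and \<open>kap * R = l * D / 14\<close>, this is where the
    restriction on \<open>L\<close> enters.\<close>
  have "4 * eps * n \<le> 4 * eps * (4 * real L * k)"
    using nw eps_pos by (intro mult_left_mono) (auto simp: n_def k_def)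
  also have "\<dots> = (real L * (224 * eps)) * k / 14"
    by simp
  also have "\<dots> \<le> l * D * k / 14"
    using L_le nonneg by (intro divide_right_mono mult_right_mono) auto
  also have "\<dots> = kap * R * k"
    by (simp add: kap_def R_def)
  finally have "t * (4 * eps * n) \<le> t * (kap * R * k)"
    using t by (intro mult_left_mono) auto
  note val = order_trans[OF val diff_left_mono[OF this]]
  have "L2_set (\<lambda>j. z j + t * w j - c j) {..<N} \<le> q + L2_set (\<lambda>j. t * w j) {..<N}"
    using L2_set_triangle_ineq[of "\<lambda>j. z j - c j" "\<lambda>j. t * w j" "{..<N}"]
    by (simp add: q_def algebra_simps)
  also have "L2_set (\<lambda>j. t * w j) {..<N} = t * n"
    using t by (simp add: L2_set_right_distrib n_def)
  finally have "(L2_set (\<lambda>j. z j + t * w j - c j) {..<N})\<^sup>2 \<le> (q + t * n)\<^sup>2"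
    by (intro power_mono) auto
  also have "\<dots> = q\<^sup>2 + (2 * q + t * n) * (t * n)"
    by (simp add: power2_eq_square algebra_simps)
  also have "\<dots> \<le> q\<^sup>2 + (2 * (eps / l) + eps / l) * (t * n)"
    using zc t nonneg by (intro add_left_mono mult_right_mono add_mono mult_left_mono)
      (auto simp: q_def n_def)
  finally have "l * (L2_set (\<lambda>j. z j + t * w j - c j) {..<N})\<^sup>2
      \<le> l * (q\<^sup>2 + (2 * (eps / l) + eps / l) * (t * n))"
    using l_pos by (intro mult_left_mono) auto
  also have "\<dots> = l * q\<^sup>2 + 3 * eps * (t * n)"
    using l_pos by (simp add: field_simps)
  finally show ?thesis
    using val unfolding n_def[symmetric] q_def[symmetric] by (simp add: algebra_simps)
qed

text \<open>Moves the first block whose end coordinates are still below \<open>P\<close> upwards along \<open>1 / wt\<close>.\<close>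
lemma shift_step:
  assumes z: "\<And>j. j < N \<Longrightarrow> z j \<ge> 0" and flat: "\<And>j. j < N \<Longrightarrow> wt j * z j = m (j div L)"
    and zc: "L2_set (\<lambda>j. z j - c j) {..<N} \<le> 2 * (eps / l)" and c: "c (N - 1) = 0"
  obtains z' where "\<And>j. j < N \<Longrightarrow> z' j \<ge> 0"
    "val z' + l * (L2_set (\<lambda>j. z' j - c j) {..<N})\<^sup>2
      \<le> val z + l * (L2_set (\<lambda>j. z j - c j) {..<N})\<^sup>2 - eps\<^sup>2 / l"
proof -
  define t where "t = eps / l"
  have t: "t > 0" "t \<le> P" "l * t = eps"
    using eps_pos l_pos by (auto simp: t_def P_def field_simps)
  have ends: "z (b * L + L - 1) = z (b * L)" if "b < K" for b
  proof -
    have "(b * L + L - 1) div L = b"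
      using L_pos by (intro block_div) auto
    then have "wt (b * L + L - 1) * z (b * L + L - 1) = m b"
      using flat[of "b * L + L - 1"] block_less_N[OF that, of "L - 1"] L_pos
      by simp
    moreover have "wt (b * L) * z (b * L) = m b"
      using flat[of "b * L"] block_less_N[OF that, of 0] L_pos by simp
    moreover have "wt (b * L + L - 1) = wt (b * L)"
      using L_pos by (simp add: wt_def)
    ultimately have "wt (b * L) * z (b * L + L - 1) = wt (b * L) * z (b * L)"
      by simp
    then show ?thesis
      using wt_pos[of "b * L"] by (simp only: mult_cancel_left) simp
  qed
  \<comment> \<open>As \<open>c\<close> vanishes at the last coordinate and \<open>z\<close> is near
    \<open>c\<close>, the last block is still low; hence a first low block exists.\<close>
  have "z (N - 1) \<le> \<bar>z (N - 1) - c (N - 1)\<bar>"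
    by (simp only: c diff_zero abs_ge_self)
  also have "\<dots> \<le> L2_set (\<lambda>j. \<bar>z j - c j\<bar>) {..<N}"
    using N_pos by (intro member_le_L2_set[where f = "\<lambda>j. \<bar>z j - c j\<bar>"]) auto
  also have "\<dots> = L2_set (\<lambda>j. z j - c j) {..<N}"
    by (simp add: L2_set_def)
  also have "\<dots> < P"
    using zc t eps_pos l_pos by (auto simp: P_def field_simps)
  finally have "z (N - 1) < P" .
  moreover have "N - 1 = (K - 1) * L + L - 1"
    using K_pos unfolding N_def by (cases K) auto
  ultimately have "z ((K - 1) * L) < P"
    using ends[of "K - 1"] K_pos by simp
  then have ex: "\<exists>b. b < K \<and> z (b * L) < P"
    using K_pos by (intro exI[of _ "K - 1"]) auto
  define b where "b = (LEAST b. b < K \<and> z (b * L) < P)"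
  have b: "b < K" "z (b * L) < P"
    using LeastI_ex[OF ex] by (auto simp: b_def)
  have bN: "b * L < N"
    using block_less_N[OF b(1), of 0] L_pos by simp
  have passed: "z (b' * L) \<ge> P" if "b' < b" for b'
    using not_less_Least[of b' "\<lambda>b. b < K \<and> z (b * L) < P"] that b(1) unfolding b_def[symmetric] by auto
  \<comment> \<open>The previous block is not low, and by \<open>ends\<close> its last coordinate
    has also reached \<open>P\<close>.\<close>
  have gate_z: "gate z (b * L) = 1"
  proof (cases b)
    case (Suc b')
    then have "z (b * L - 1) \<ge> P"
      using passed[of b'] ends[of b'] b(1) by (simp add: add.commute)
    then show ?thesis
      using P_pos by (simp add: gate_def ramp_eq_1)
  qed (simp add: gate_def)
  \<comment> \<open>A multiple of \<open>1 / wt\<close> on block \<open>b\<close>, so no link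
    changes; it is scaled so that the ends of the block move by exactly \<open>t\<close>.\<close>
  define u where "u j = (if j div L = b then t / sqrt L / wt j else 0)" for j
  have u: "u j \<ge> 0" for j
    using t wt_pos[of j] by (simp add: u_def)
  have ub: "u (b * L) = t"
    using L_pos by (simp add: u_def wt_def)
  define z' where "z' j = z j + u j" for j
  have link_u: "link u j = 0" for j
  proof (cases "L dvd j")
    case False
    then show ?thesis
      using pred_div_L[OF False] wt_pos[of j] wt_pos[of "j - 1"] by (auto simp: link_def u_def)
  qed (simp add: link_def)
  have "link z' j = link z j" for j
    using link_u[of j] by (auto simp: link_def z'_def algebra_simps)
  then have link_z': "link z' = link z" by auto
  have mono: "gain z j \<le> gain z' j" if "j < N" for j
    using z u that by (intro gain_mono) (auto simp: z'_def)
  have "gain z' (b * L) - gain z (b * L) \<ge> t / (4 * P)"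
  proof -
    have "gate z (b * L) \<le> gate z' (b * L)"
      using u P_pos by (auto simp: gate_def z'_def intro!: ramp_mono divide_right_mono)
    then have "gate z' (b * L) = 1"
      using gate_le_1[of z' "b * L"] by (simp add: gate_z)
    moreover have "ramp (z (b * L) / (2 * P) + t / (2 * P)) - ramp (z (b * L) / (2 * P)) \<ge> t / (2 * P) / 2"
      using b z[OF bN] t P_pos by (intro ramp_increment) (auto simp: field_simps)
    ultimately show ?thesis
      by (simp add: gain_def gate_z z'_def ub add_divide_distrib)
  qed
  then have "(\<Sum>j<N. if j = b * L then t / (4 * P) else 0) \<le> (\<Sum>j<N. gain z' j - gain z j)"
    using mono by (intro sum_mono) auto
  then have "t / (4 * P) \<le> (\<Sum>j<N. gain z' j) - (\<Sum>j<N. gain z j)"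
    using bN by (simp add: sum_subtractf)
  then have "A * (t / (4 * P)) \<le> A * ((\<Sum>j<N. gain z' j) - (\<Sum>j<N. gain z j))"
    using A_pos by (intro mult_left_mono) auto
  \<comment> \<open>This is \<open>kap * P * t / 8\<close>, and 616 / (7 * 8) = 11, one more than
    the proximal cost of 10 computed below.\<close>
  moreover have "A * (t / (4 * P)) = 11 * eps * t"
    using l_pos eps_pos by (simp add: A_def P_def kap_def field_simps power2_eq_square)
  ultimately have val: "val z' \<le> val z - 11 * eps * t"
    unfolding val_def link_z' by (simp add: algebra_simps)
  have "(\<Sum>j<N. (u j)\<^sup>2) = (\<Sum>j\<in>{b * L..<b * L + L}. (u j)\<^sup>2)"
    using block_subset[OF b(1)] L_pos in_block
    by (intro sum.mono_neutral_right) (auto simp: u_def)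
  also have "\<dots> = (\<Sum>j\<in>{b * L..<b * L + L}. t\<^sup>2 / real L * (1 / wt j)\<^sup>2)"
    by (intro sum.cong refl, simp only: u_def block_div)
      (simp only: power_divide real_sqrt_pow2 of_nat_0_le_iff power_one if_True simp_thms
        times_divide_eq_right mult_1_right)
  also have "\<dots> \<le> t\<^sup>2 / real L * (3 * real L)"
    unfolding sum_distrib_left[symmetric] by (intro mult_left_mono sum_inverse_wt_block) auto
  also have "\<dots> = 3 * t\<^sup>2"
    using L_pos by simp
  finally have u2: "(L2_set u {..<N})\<^sup>2 \<le> 3 * t\<^sup>2"
    by (simp add: L2_set_def sum_nonneg)
  also have "3 * t\<^sup>2 \<le> (7 / 4 * t)\<^sup>2"
    by (simp add: power_mult_distrib power_divide)
  finally have un: "L2_set u {..<N} \<le> 7 / 4 * t"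
    by (rule power2_le_imp_le) (use t in simp)
  define q where "q = L2_set (\<lambda>j. z j - c j) {..<N}"
  have q: "0 \<le> q" "q \<le> 2 * t" using zc by (auto simp: q_def t_def)
  have "L2_set (\<lambda>j. z' j - c j) {..<N} \<le> q + L2_set u {..<N}"
    using L2_set_triangle_ineq[of "\<lambda>j. z j - c j" u "{..<N}"]
    by (simp add: q_def z'_def algebra_simps)
  then have "(L2_set (\<lambda>j. z' j - c j) {..<N})\<^sup>2 \<le> (q + L2_set u {..<N})\<^sup>2"
    by (intro power_mono) auto
  also have "\<dots> = q\<^sup>2 + 2 * (q * L2_set u {..<N}) + (L2_set u {..<N})\<^sup>2"
    by (simp add: power2_sum)
  \<comment> \<open>The 7/4 bounds the square root of 3; the cross term costs 7 and the square
    3.\<close>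
  also have "\<dots> \<le> q\<^sup>2 + 2 * (2 * t * (7 / 4 * t)) + 3 * t\<^sup>2"
    using q un u2 t by (intro add_mono mult_left_mono mult_mono) auto
  also have "\<dots> = q\<^sup>2 + 10 * t\<^sup>2"
    by (simp add: power2_eq_square)
  finally have "l * (L2_set (\<lambda>j. z' j - c j) {..<N})\<^sup>2 \<le> l * (q\<^sup>2 + 10 * t\<^sup>2)"
    using l_pos by (intro mult_left_mono) auto
  also have "\<dots> = l * q\<^sup>2 + 10 * eps * t"
    using t(3) by (simp add: power2_eq_square algebra_simps)
  finally have "val z' + l * (L2_set (\<lambda>j. z' j - c j) {..<N})\<^sup>2 \<le> val z + l * q\<^sup>2 - eps * t"
    using val by simp
  moreover have "eps * t = eps\<^sup>2 / l"
    by (simp add: t_def power2_eq_square)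
  ultimately show thesis
    using z u by (intro that[of z']) (auto simp: z'_def q_def)
qed

text \<open>If the flattening direction is long, a partial step of length \<open>eps / l\<close>
  already decreases the objective enough. If it is short, full flattening does not increase the
  objective and leaves the distance to \<open>c\<close> at most \<open>2 * (eps / l)\<close>, so
  \<open>shift_step\<close> applies.\<close>

lemma descent:
  assumes z: "\<And>j. j < N \<Longrightarrow> z j \<ge> 0" and zc: "L2_set (\<lambda>j. z j - c j) {..<N} \<le> eps / l"
    and c: "c (N - 1) = 0"
  obtains z' where "\<And>j. j < N \<Longrightarrow> z' j \<ge> 0"
    "val z' + l * (L2_set (\<lambda>j. z' j - c j) {..<N})\<^sup>2
      \<le> val z + l * (L2_set (\<lambda>j. z j - c j) {..<N})\<^sup>2 - eps\<^sup>2 / l"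
proof -
  obtain w m where w: "\<And>j. j < N \<Longrightarrow> w j \<ge> 0" "\<And>j. j < N \<Longrightarrow> link w j = - link z j"
    "L2_set w {..<N} \<le> 4 * real L * L2_set (link z) {..<N}"
    and flat: "\<And>j. j < N \<Longrightarrow> wt j * (z j + w j) = m (j div L)"
    using flattening_direction[of z] z by blast
  define n where "n = L2_set w {..<N}"
  have n: "n \<ge> 0" by (simp add: n_def)
  show thesis
  proof (cases "n \<le> eps / l")
    case True
    have "val (\<lambda>j. z j + 1 * w j) + l * (L2_set (\<lambda>j. z j + 1 * w j - c j) {..<N})\<^sup>2
        \<le> val z + l * (L2_set (\<lambda>j. z j - c j) {..<N})\<^sup>2 - 1 * L2_set w {..<N} * eps"
      using True by (intro flattening_step[OF z zc w]) (auto simp: n_def)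
    then have le: "val (\<lambda>j. z j + w j) + l * (L2_set (\<lambda>j. z j + w j - c j) {..<N})\<^sup>2
        \<le> val z + l * (L2_set (\<lambda>j. z j - c j) {..<N})\<^sup>2"
      using mult_nonneg_nonneg[OF n less_imp_le[OF eps_pos]] by (simp add: n_def)
    have "L2_set (\<lambda>j. (z j - c j) + w j) {..<N} \<le> 2 * (eps / l)"
      using order_trans[OF L2_set_triangle_ineq add_mono[OF zc True[unfolded n_def]]] by simp
    then have "L2_set (\<lambda>j. z j + w j - c j) {..<N} \<le> 2 * (eps / l)"
      by (simp add: algebra_simps)
    then obtain z' where "\<And>j. j < N \<Longrightarrow> z' j \<ge> 0"
      "val z' + l * (L2_set (\<lambda>j. z' j - c j) {..<N})\<^sup>2
        \<le> val (\<lambda>j. z j + w j) + l * (L2_set (\<lambda>j. z j + w j - c j) {..<N})\<^sup>2 - eps\<^sup>2 / l"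
      using shift_step[of "\<lambda>j. z j + w j" m c] z w(1) flat c by (auto intro: add_nonneg_nonneg)
    then show thesis
      using le by (intro that[of z']) auto
  next
    case False
    define t where "t = eps / (l * n)"
    have n: "n > 0" using False eps_pos l_pos by (meson divide_pos_pos less_trans not_le)
    have t: "0 \<le> t" "t \<le> 1" "t * n = eps / l"
      using False n l_pos eps_pos by (auto simp: t_def field_simps)
    have "val (\<lambda>j. z j + t * w j) + l * (L2_set (\<lambda>j. z j + t * w j - c j) {..<N})\<^sup>2
        \<le> val z + l * (L2_set (\<lambda>j. z j - c j) {..<N})\<^sup>2 - t * L2_set w {..<N} * eps"
      using t by (intro flattening_step[OF z zc w]) (auto simp: n_def)
    then show thesis
      using z w(1) t by (intro that[of "\<lambda>j. z j + t * w j"]) (auto simp: n_def power2_eq_square)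
  qed
qed

end

subsection \<open>The instance as a member of the function class\<close>

lemma vnorm_nonneg [simp]: "vnorm v \<ge> 0"
  by (simp add: vnorm_def)

lemma vnorm_sq: "(vnorm v)\<^sup>2 = (\<Sum>i<dim_vec v. (v $ i)\<^sup>2)"
  by (simp add: vnorm_def L2_set_def sum_nonneg)

lemma vnorm_minus_eq:
  "v \<in> carrier_vec n \<Longrightarrow> w \<in> carrier_vec n \<Longrightarrow> vnorm (v - w) = L2_set (\<lambda>i. v $ i - w $ i) {..<n}"
  by (auto simp: vnorm_def intro!: L2_set_cong)

lemma abs_index_le_vnorm: "i < dim_vec v \<Longrightarrow> \<bar>v $ i\<bar> \<le> vnorm v"
  using member_le_L2_set[of "{..<dim_vec v}" i "\<lambda>i. \<bar>v $ i\<bar>"]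
  by (simp add: vnorm_def L2_set_def)

lemma vnorm_add_le:
  assumes "v \<in> carrier_vec n" "w \<in> carrier_vec n"
  shows "vnorm (v + w) \<le> vnorm v + vnorm w"
proof -
  have "vnorm (v + w) = L2_set (\<lambda>i. v $ i + w $ i) {..<n}"
    using assms by (auto simp: vnorm_def intro!: L2_set_cong)
  also have "\<dots> \<le> vnorm v + vnorm w"
    using assms L2_set_triangle_ineq[of "($) v" "($) w" "{..<n}"] by (simp add: vnorm_def)
  finally show ?thesis .
qed

lemma vnorm_minus_commute:
  "v \<in> carrier_vec n \<Longrightarrow> w \<in> carrier_vec n \<Longrightarrow> vnorm (v - w) = vnorm (w - v)"
  by (simp add: vnorm_minus_eq L2_set_def power2_commute)

lemma vnorm_minus_le:
  assumes "v \<in> carrier_vec n" "w \<in> carrier_vec n"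
  shows "vnorm (v - w) \<le> vnorm v + vnorm w"
proof -
  have "v - w = v + - w" using assms by auto
  moreover have "vnorm (- w) = vnorm w"
    by (simp add: vnorm_def L2_set_def)
  ultimately show ?thesis
    using vnorm_add_le[of v n "- w"] assms by simp
qed

lemma vnorm_append_sq: "(vnorm (v @\<^sub>v w))\<^sup>2 = (vnorm v)\<^sup>2 + (vnorm w)\<^sup>2"
proof -
  have "(vnorm (v @\<^sub>v w))\<^sup>2
      = (\<Sum>i\<in>{0..<dim_vec v}. (v $ i)\<^sup>2) + (\<Sum>i\<in>{dim_vec v..<dim_vec v + dim_vec w}. (w $ (i - dim_vec v))\<^sup>2)"
    unfolding vnorm_sq atLeast0LessThan[symmetric]
    by (subst sum.atLeastLessThan_concat[symmetric, of 0 "dim_vec v"]) (auto intro!: sum.cong)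
  also have "(\<Sum>i\<in>{dim_vec v..<dim_vec v + dim_vec w}. (w $ (i - dim_vec v))\<^sup>2) = (\<Sum>i<dim_vec w. (w $ i)\<^sup>2)"
    using sum.shift_bounds_nat_ivl[of "\<lambda>i. (w $ (i - dim_vec v))\<^sup>2" 0 "dim_vec v" "dim_vec w"]
    by (simp add: atLeast0LessThan add.commute)
  finally show ?thesis
    by (simp add: vnorm_sq atLeast0LessThan)
qed

lemma append_vec_minus:
  assumes "v \<in> carrier_vec n" "v' \<in> carrier_vec n" "w \<in> carrier_vec m" "w' \<in> carrier_vec m"
  shows "(v @\<^sub>v w) - (v' @\<^sub>v w') = (v - v') @\<^sub>v (w - w')"
  using assms by (intro eq_vecI) auto

lemma vec_first_append: "v \<in> carrier_vec n \<Longrightarrow> vec_first (v @\<^sub>v w) n = v"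
  by (intro eq_vecI) (auto simp: vec_first_def)

lemma vec_last_append: "w \<in> carrier_vec m \<Longrightarrow> vec_last (v @\<^sub>v w) m = w"
  by (intro eq_vecI) (auto simp: vec_last_def)

section \<open>The orthant and the ball as closed convex domains\<close>

lemma closed_vecI:
  assumes "S \<subseteq> carrier_vec n"
    and "\<And>v. v \<in> carrier_vec n \<Longrightarrow> v \<notin> S \<Longrightarrow> \<exists>r>0. \<forall>w\<in>S. r \<le> vnorm (v - w)"
  shows "closed_vec n S"
proof -
  interpret M: Metric_space "carrier_vec n" "vdist n"
    by (rule Metric_space_vdist)
  have "\<exists>r>0. M.mball v r \<subseteq> carrier_vec n - S" if "v \<in> carrier_vec n - S" for v
    using assms that by (force simp: vdist_eq_vnorm M.in_mball)
  then show ?thesis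
    using assms(1) by (auto simp: closed_vec_def closedin_def M.openin_mtopology)
qed

lemma admissible_orthant:
  assumes "n \<ge> 1"
  shows "admissible_domain n {x \<in> carrier_vec n. \<forall>i<n. x $ i \<ge> 0}"
proof -
  let ?X = "{x :: real vec. x \<in> carrier_vec n \<and> (\<forall>i<n. x $ i \<ge> 0)}"
  have "closed_vec n ?X"
  proof (rule closed_vecI)
    fix v :: "real vec" assume v: "v \<in> carrier_vec n" "v \<notin> ?X"
    then obtain i where i: "i < n" "v $ i < 0" by force
    have "- v $ i \<le> vnorm (v - w)" if "w \<in> ?X" for w
    proof -
      have "- v $ i \<le> \<bar>(v - w) $ i\<bar>"
        using that v i by auto
      also have "\<dots> \<le> vnorm (v - w)"
        using that i v by (intro abs_index_le_vnorm) auto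
      finally show ?thesis .
    qed
    then show "\<exists>r>0. \<forall>w\<in>?X. r \<le> vnorm (v - w)"
      using i by (intro exI[of _ "- v $ i"]) auto
  qed auto
  then show ?thesis
    using assms by (auto simp: admissible_domain_def convex_vec_def)
qed

lemma admissible_ball:
  assumes "n \<ge> 1" "r \<ge> 0"
  shows "admissible_domain n {y \<in> carrier_vec n. vnorm y \<le> r}"
proof -
  let ?Y = "{y \<in> carrier_vec n. vnorm y \<le> r}"
  have "closed_vec n ?Y"
  proof (rule closed_vecI)
    fix v assume v: "v \<in> carrier_vec n" "v \<notin> ?Y"
    have "vnorm v - r \<le> vnorm (v - w)" if w: "w \<in> ?Y" for w
    proof -
      have "v = (v - w) + w" using v w by auto
      then have "vnorm v \<le> vnorm (v - w) + vnorm w"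
        using vnorm_add_le[of "v - w" n w] v w by auto
      then show ?thesis using w by auto
    qed
    then show "\<exists>r>0. \<forall>w\<in>?Y. r \<le> vnorm (v - w)"
      using v by (intro exI[of _ "vnorm v - r"]) auto
  qed auto
  moreover have "convex_vec ?Y"
    unfolding convex_vec_def
  proof (intro ballI)
    fix v w :: "real vec" and t :: real
    assume a: "v \<in> ?Y" "w \<in> ?Y" "t \<in> {0..1}"
    have "vnorm ((1 - t) \<cdot>\<^sub>v v + t \<cdot>\<^sub>v w) \<le> (1 - t) * vnorm v + t * vnorm w"
      using a vnorm_add_le[of "(1 - t) \<cdot>\<^sub>v v" n "t \<cdot>\<^sub>v w"] by (simp add: vnorm_smult)
    also have "\<dots> \<le> r"
      using a by (intro convex_bound_le) auto
    finally show "(1 - t) \<cdot>\<^sub>v v + t \<cdot>\<^sub>v w \<in> ?Y"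
      using a by auto
  qed
  moreover have "vnorm (0\<^sub>v n) = 0"
    by (simp add: vnorm_def L2_set_0')
  ultimately show ?thesis
    using assms by (auto simp: admissible_domain_def)
qed

lemma diam_ball_le: "diam_vec {y \<in> carrier_vec n. vnorm y \<le> r} \<le> ereal (2 * r)"
  unfolding diam_vec_def
proof (intro SUP_least)
  fix v w assume "v \<in> {y \<in> carrier_vec n. vnorm y \<le> r}" "w \<in> {y \<in> carrier_vec n. vnorm y \<le> r}"
  then show "ereal (vnorm (v - w)) \<le> ereal (2 * r)"
    using vnorm_minus_le[of v n w] by auto
qed

section \<open>Gradient, smoothness and concavity of the instance\<close>

context hard_instance
begin

text \<open>The orthant keeps ramps at nonnegative arguments, where they lie in [0, 1] with slope at
  most 2; below 0 they grow quadratically, and a product of two would not have a Lipschitz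
  gradient.\<close>

definition X :: "real vec set" where "X = {x \<in> carrier_vec N. \<forall>i<N. x $ i \<ge> 0}"
definition Y :: "real vec set" where "Y = {y \<in> carrier_vec N. vnorm y \<le> R}"

definition F :: saddle where
  "F = \<lparr>xdim = N, ydim = N, xdom = X, ydom = Y, obj = (\<lambda>x y. \<Sum>j<N. cell (($) x) (($) y) j)\<rparr>"

definition grad_vec :: "real vec \<Rightarrow> real vec \<Rightarrow> real vec" where
  "grad_vec x y = vec N (grad_x_at (($) x) (($) y)) @\<^sub>v vec N (\<lambda>j. kap * link (($) x) j)"

lemma F_simps [simp]: "xdim F = N" "ydim F = N" "xdom F = X" "ydom F = Y"
  "obj F x y = (\<Sum>j<N. cell (($) x) (($) y) j)" "joint_dim F = N + N"
  by (simp_all add: F_def joint_dim_def)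

lemma X_D: "x \<in> X \<Longrightarrow> x \<in> carrier_vec N" "x \<in> X \<Longrightarrow> j < N \<Longrightarrow> x $ j \<ge> 0"
  by (auto simp: X_def)

lemma Y_D: "y \<in> Y \<Longrightarrow> y \<in> carrier_vec N" "y \<in> Y \<Longrightarrow> vnorm y \<le> R"
  by (auto simp: Y_def)

lemma admissible_X: "admissible_domain N X" and admissible_Y: "admissible_domain N Y"
  using admissible_orthant[of N] admissible_ball[of N R] N_pos R_pos by (auto simp: X_def Y_def)

lemma zero_X: "0\<^sub>v N \<in> X" and zero_Y: "0\<^sub>v N \<in> Y"
  using admissible_X admissible_Y by (auto simp: admissible_domain_def)

lemma joint_obj_F: "x \<in> X \<Longrightarrow> y \<in> Y \<Longrightarrow> joint_obj F (x @\<^sub>v y) = (\<Sum>j<N. cell (($) x) (($) y) j)"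
  using X_D Y_D by (simp add: joint_obj_def vec_first_append vec_last_append)

lemma grad_vec_carrier: "grad_vec x y \<in> carrier_vec (N + N)"
  by (auto simp: grad_vec_def)

lemma joint_dom_F: "z \<in> joint_dom F \<longleftrightarrow> (\<exists>x\<in>X. \<exists>y\<in>Y. z = x @\<^sub>v y)"
  by (auto simp: joint_dom_def)

text \<open>Together with \<open>unit_y\<close> this shows that the joint domain spans the whole
  space, which settles the span condition in \<open>has_gradient\<close>.\<close>

lemma unit_x: "i < N \<Longrightarrow> unit_vec N i @\<^sub>v 0\<^sub>v N \<in> joint_dom F"
  unfolding joint_dom_F using zero_Y by (intro bexI[of _ "unit_vec N i"] bexI[of _ "0\<^sub>v N"]) (auto simp: X_def unit_vec_def)

lemma unit_y: "i < N \<Longrightarrow> 0\<^sub>v N @\<^sub>v R \<cdot>\<^sub>v unit_vec N i \<in> joint_dom F"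
proof -
  assume i: "i < N"
  have "(vnorm (unit_vec N i))\<^sup>2 = 1"
    using i unfolding vnorm_sq by (simp add: unit_vec_def if_distrib[of "\<lambda>x. x\<^sup>2"] cong: if_cong)
  then have "vnorm (unit_vec N i) = 1"
    by (simp add: power2_eq_1_iff) (metis vnorm_nonneg not_one_le_zero neg_0_le_iff_le)
  then have "R \<cdot>\<^sub>v unit_vec N i \<in> Y"
    using R_pos by (simp add: Y_def vnorm_smult)
  then show ?thesis
    unfolding joint_dom_F using zero_X by blast
qed

lemma has_gradient_F:
  assumes x: "x \<in> X" and y: "y \<in> Y"
  shows "has_gradient (N + N) (joint_dom F) (joint_obj F) (grad_vec x y) (x @\<^sub>v y)"
  unfolding has_gradient_def
proof (intro conjI allI impI ballI)
  show "grad_vec x y \<in> carrier_vec (N + N)"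
    by (rule grad_vec_carrier)
next
  fix e :: real assume e: "e > 0"
  show "\<exists>d>0. \<forall>w\<in>joint_dom F. vnorm (w - (x @\<^sub>v y)) < d \<longrightarrow>
    \<bar>joint_obj F w - joint_obj F (x @\<^sub>v y) - scalar_prod (grad_vec x y) (w - (x @\<^sub>v y))\<bar>
      \<le> e * vnorm (w - (x @\<^sub>v y))"
  \<comment> \<open>The remainder is at most \<open>6 * kap\<close> times the squared
    distance.\<close>
  proof (intro exI[of _ "e / (6 * kap)"] conjI ballI impI)
    show "0 < e / (6 * kap)" using e kap_pos by simp
    fix w assume w: "w \<in> joint_dom F" and near: "vnorm (w - (x @\<^sub>v y)) < e / (6 * kap)"
    obtain x' y' where w_eq: "w = x' @\<^sub>v y'" and x': "x' \<in> X" and y': "y' \<in> Y"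
      using w joint_dom_F by auto
    note [simp] = x[THEN X_D(1)] x'[THEN X_D(1)] y[THEN Y_D(1)] y'[THEN Y_D(1)]
    have diff: "w - (x @\<^sub>v y) = (x' - x) @\<^sub>v (y' - y)"
      unfolding w_eq by (rule append_vec_minus[of _ N _ _ N]) auto
    have [simp]: "dim_vec x = N" "dim_vec x' = N" "dim_vec y = N" "dim_vec y' = N"
      by (auto simp: carrier_vecD[of _ N])
    have sp: "scalar_prod (grad_vec x y) (w - (x @\<^sub>v y))
        = (\<Sum>j<N. grad_x_at (($) x) (($) y) j * (x' $ j - x $ j)) + (\<Sum>j<N. kap * link (($) x) j * (y' $ j - y $ j))"
      unfolding diff grad_vec_def
      by (subst scalar_prod_append[of _ N _ N]) (auto simp: scalar_prod_def atLeast0LessThan)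
    have nm: "(vnorm (w - (x @\<^sub>v y)))\<^sup>2 = (\<Sum>j<N. (x' $ j - x $ j)\<^sup>2) + (\<Sum>j<N. (y' $ j - y $ j)\<^sup>2)"
      unfolding diff vnorm_append_sq by (simp add: vnorm_sq)
    have "\<bar>joint_obj F w - joint_obj F (x @\<^sub>v y) - scalar_prod (grad_vec x y) (w - (x @\<^sub>v y))\<bar>
        \<le> 6 * kap * (vnorm (w - (x @\<^sub>v y)))\<^sup>2"
      unfolding sp nm unfolding w_eq joint_obj_F[OF x y] joint_obj_F[OF x' y']
      using sum_cell_taylor[of "($) x" "($) x'" "($) y'" "($) y"] X_D[OF x] X_D[OF x']
      by (simp add: algebra_simps)
    also have "\<dots> = 6 * kap * vnorm (w - (x @\<^sub>v y)) * vnorm (w - (x @\<^sub>v y))"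
      by (simp add: power2_eq_square)
    also have "\<dots> \<le> e * vnorm (w - (x @\<^sub>v y))"
      using near kap_pos by (intro mult_right_mono) (auto simp: field_simps)
    finally show "\<bar>joint_obj F w - joint_obj F (x @\<^sub>v y) - scalar_prod (grad_vec x y) (w - (x @\<^sub>v y))\<bar>
        \<le> e * vnorm (w - (x @\<^sub>v y))" .
  qed
next
  fix v :: "real vec" assume v: "v \<in> carrier_vec (N + N)"
    and orth: "\<forall>w\<in>joint_dom F. scalar_prod v (w - (x @\<^sub>v y)) = 0"
  define v1 v2 where "v1 = vec_first v N" and "v2 = vec_last v N"
  have v12: "v = v1 @\<^sub>v v2" "v1 \<in> carrier_vec N" "v2 \<in> carrier_vec N"
    using v by (auto simp: v1_def v2_def)
  have zc: "x @\<^sub>v y \<in> carrier_vec (N + N)"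
    using X_D(1)[OF x] Y_D(1)[OF y] by auto
  have sp: "scalar_prod v w = scalar_prod v (x @\<^sub>v y)" if "w \<in> joint_dom F" for w
  proof -
    have "w \<in> carrier_vec (N + N)"
      using that X_D(1) Y_D(1) unfolding joint_dom_F by auto
    then show ?thesis
      using orth that v zc by (auto simp: scalar_prod_minus_distrib[of _ "N + N"])
  qed
  \<comment> \<open>Since the origin is in the domain, orthogonality to differences becomes
    orthogonality to the domain itself.\<close>
  have "0\<^sub>v N @\<^sub>v 0\<^sub>v N \<in> joint_dom F"
    using zero_X zero_Y joint_dom_F by auto
  from sp[OF this] have "scalar_prod v (x @\<^sub>v y) = 0"
    using v12 by (simp add: scalar_prod_append[of _ N _ N])
  then have sp0: "scalar_prod v w = 0" if "w \<in> joint_dom F" for w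
    using sp[OF that] by simp
  have "v1 $ i = 0" if "i < N" for i
    using sp0[OF unit_x[OF that]] v12 that
    by (simp add: scalar_prod_append[of _ N _ N])
  moreover have "v2 $ i = 0" if "i < N" for i
    using sp0[OF unit_y[OF that]] v12 that R_pos
    by (simp add: scalar_prod_append[of _ N _ N])
  ultimately have "v = 0\<^sub>v (N + N)"
    using v12 by (intro eq_vecI) auto
  then show "scalar_prod v (grad_vec x y) = 0"
    using grad_vec_carrier by simp
qed

lemma grad_F:
  assumes "x \<in> X" "y \<in> Y"
  shows "grad F x y = grad_vec x y"
proof -
  have sub: "joint_dom F \<subseteq> carrier_vec (N + N)"
    using X_D(1) Y_D(1) by (auto simp: joint_dom_F)
  have conv: "convex_vec (joint_dom F)"
    unfolding convex_vec_def
  proof (intro ballI)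
    fix v w :: "real vec" and t :: real
    assume "v \<in> joint_dom F" "w \<in> joint_dom F" and t: "t \<in> {0..1}"
    then obtain x y x' y' where e: "v = x @\<^sub>v y" "w = x' @\<^sub>v y'" "x \<in> X" "y \<in> Y" "x' \<in> X" "y' \<in> Y"
      by (auto simp: joint_dom_F)
    have "(1 - t) \<cdot>\<^sub>v v + t \<cdot>\<^sub>v w = ((1 - t) \<cdot>\<^sub>v x + t \<cdot>\<^sub>v x') @\<^sub>v ((1 - t) \<cdot>\<^sub>v y + t \<cdot>\<^sub>v y')"
      using X_D(1)[OF e(3)] X_D(1)[OF e(5)] Y_D(1)[OF e(4)] Y_D(1)[OF e(6)]
      unfolding e by (intro eq_vecI) auto
    moreover have "(1 - t) \<cdot>\<^sub>v x + t \<cdot>\<^sub>v x' \<in> X" "(1 - t) \<cdot>\<^sub>v y + t \<cdot>\<^sub>v y' \<in> Y"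
      using admissible_X admissible_Y e t by (auto simp: admissible_domain_def convex_vec_def)
    ultimately show "(1 - t) \<cdot>\<^sub>v v + t \<cdot>\<^sub>v w \<in> joint_dom F"
      unfolding joint_dom_F by blast
  qed
  have mem: "x @\<^sub>v y \<in> joint_dom F"
    using assms joint_dom_F by auto
  show ?thesis
    unfolding grad_def gradient_def F_simps
    using has_gradient_F[OF assms] has_gradient_unique[OF sub conv mem] by blast
qed

lemma differentiable_F: "differentiable_saddle F"
  unfolding differentiable_saddle_def
  using admissible_X admissible_Y has_gradient_F by (auto simp: joint_dom_F) blast

lemma smooth_F: "smooth_saddle l F"
  unfolding smooth_saddle_def F_simps
proof (intro ballI)
  fix x1 y1 x2 y2 assume a: "x1 \<in> X" "y1 \<in> Y" "x2 \<in> X" "y2 \<in> Y"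
  note d [simp] = carrier_vecD[OF X_D(1)[OF a(1)]] carrier_vecD[OF Y_D(1)[OF a(2)]]
    carrier_vecD[OF X_D(1)[OF a(3)]] carrier_vecD[OF Y_D(1)[OF a(4)]]
  have g: "grad_vec x1 y1 - grad_vec x2 y2
     = (vec N (grad_x_at (($) x1) (($) y1)) - vec N (grad_x_at (($) x2) (($) y2)))
       @\<^sub>v (vec N (\<lambda>j. kap * link (($) x1) j) - vec N (\<lambda>j. kap * link (($) x2) j))"
    unfolding grad_vec_def by (rule append_vec_minus[of _ N _ _ N]) auto
  have z: "(x1 @\<^sub>v y1) - (x2 @\<^sub>v y2) = (x1 - x2) @\<^sub>v (y1 - y2)"
    using a X_D Y_D by (intro append_vec_minus[of _ N _ _ N]) auto
  have "(vnorm (grad_vec x1 y1 - grad_vec x2 y2))\<^sup>2 \<le> l\<^sup>2 * (vnorm ((x1 @\<^sub>v y1) - (x2 @\<^sub>v y2)))\<^sup>2"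
    unfolding g z vnorm_append_sq
    using gradient_lipschitz[of "($) x1" "($) x2" "($) y1" "($) y2"] X_D a
    by (simp add: vnorm_sq)
  then have "(vnorm (grad_vec x1 y1 - grad_vec x2 y2))\<^sup>2 \<le> (l * vnorm ((x1 @\<^sub>v y1) - (x2 @\<^sub>v y2)))\<^sup>2"
    by (simp add: power_mult_distrib)
  then show "vnorm (grad F x1 y1 - grad F x2 y2) \<le> l * vnorm ((x1 @\<^sub>v y1) - (x2 @\<^sub>v y2))"
    unfolding grad_F[OF a(1,2)] grad_F[OF a(3,4)]
    by (rule power2_le_imp_le) (use l_pos in simp)
qed

lemma concave_F: "x \<in> X \<Longrightarrow> concave_on_vec Y (obj F x)"
  unfolding concave_on_vec_def
proof (intro ballI)
  fix v w :: "real vec" and t :: real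
  assume a: "v \<in> Y" "w \<in> Y" "t \<in> {0..1}"
  note d = carrier_vecD[OF Y_D(1)[OF a(1)]] carrier_vecD[OF Y_D(1)[OF a(2)]]
  have "obj F x ((1 - t) \<cdot>\<^sub>v v + t \<cdot>\<^sub>v w) = (\<Sum>j<N. (1 - t) * cell (($) x) (($) v) j + t * cell (($) x) (($) w) j)"
    unfolding F_simps by (intro sum.cong refl) (auto simp: cell_def d algebra_simps)
  then show "(1 - t) * obj F x v + t * obj F x w \<le> obj F x ((1 - t) \<cdot>\<^sub>v v + t \<cdot>\<^sub>v w)"
    by (simp add: sum.distrib sum_distrib_left)
qed

section \<open>Values of the primal function and class membership\<close>

lemma primal_F:
  assumes x: "x \<in> X"
  shows "primal F x = ereal (val (($) x))"
proof -
  define k where "k = L2_set (link (($) x)) {..<N}"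
  have k: "k \<ge> 0" by (simp add: k_def)
  have obj: "obj F x y = kap * (\<Sum>j<N. y $ j * link (($) x) j) - A * (\<Sum>j<N. gain (($) x) j)" for y
    by (simp add: cell_def sum_subtractf sum_distrib_left mult_ac)
  have "(SUP y\<in>Y. ereal (obj F x y)) = ereal (val (($) x))"
  proof (rule antisym)
    show "(SUP y\<in>Y. ereal (obj F x y)) \<le> ereal (val (($) x))"
    proof (intro SUP_least)
      fix y assume y: "y \<in> Y"
      have "(\<Sum>j<N. y $ j * link (($) x) j) \<le> (\<Sum>j<N. \<bar>y $ j\<bar> * \<bar>link (($) x) j\<bar>)"
        by (intro sum_mono) (simp flip: abs_mult)
      also have "\<dots> \<le> L2_set (($) y) {..<N} * k"
        unfolding k_def by (rule L2_set_mult_ineq)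
      also have "L2_set (($) y) {..<N} = vnorm y"
        using Y_D(1)[OF y] by (simp add: vnorm_def)
      also have "vnorm y * k \<le> R * k"
        using Y_D(2)[OF y] k by (intro mult_right_mono)
      finally have "kap * (\<Sum>j<N. y $ j * link (($) x) j) \<le> kap * (R * k)"
        using kap_pos by (intro mult_left_mono) auto
      then show "ereal (obj F x y) \<le> ereal (val (($) x))"
        unfolding obj val_def k_def[symmetric] by simp
    qed
    \<comment> \<open>The equality case of Cauchy-Schwarz. For \<open>k = 0\<close> division by zero
      makes \<open>y\<close> the zero vector, and the identities below still hold.\<close>
    define y where "y = vec N (\<lambda>j. R / k * link (($) x) j)"
    have "vnorm y = L2_set (\<lambda>j. R / k * link (($) x) j) {..<N}"
      unfolding vnorm_def by (auto simp: y_def intro: L2_set_cong)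
    also have "\<dots> = R / k * k"
      by (subst L2_set_right_distrib[symmetric]) (use R_pos k in \<open>auto simp: k_def\<close>)
    finally have "y \<in> Y"
      using R_pos by (auto simp: Y_def y_def divide_simps)
    have "(\<Sum>j<N. y $ j * link (($) x) j) = (\<Sum>j<N. R / k * (link (($) x) j)\<^sup>2)"
      by (intro sum.cong refl) (simp add: y_def power2_eq_square)
    also have "\<dots> = R / k * (\<Sum>j<N. (link (($) x) j)\<^sup>2)"
      by (rule sum_distrib_left[symmetric])
    also have "(\<Sum>j<N. (link (($) x) j)\<^sup>2) = k\<^sup>2"
      by (simp add: k_def L2_set_def sum_nonneg)
    finally have "val (($) x) = obj F x y"
      unfolding obj val_def k_def[symmetric] by (simp add: power2_eq_square)
    then show "ereal (val (($) x)) \<le> (SUP y\<in>Y. ereal (obj F x y))"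
      using \<open>y \<in> Y\<close> by (intro SUP_upper2[of y]) auto
  qed
  then show ?thesis
    using x by (simp add: primal_def F_def)
qed

lemma primal_F_outside: "x \<notin> X \<Longrightarrow> primal F x = \<infinity>"
proof -
  assume "x \<notin> X"
  moreover have "(SUP y\<in>Y. ereal (obj F x y)) \<noteq> -\<infinity>"
    using SUP_upper[OF zero_Y, of "\<lambda>y. ereal (obj F x y)"] by auto
  ultimately show ?thesis
    by (simp add: primal_def)
qed

text \<open>Only block starts carry a gain, one per block and at most 1, so the primal function
  drops by at most \<open>A\<close> per block.\<close>

lemma val_ge: "x \<in> X \<Longrightarrow> val (($) x) \<ge> - A * K"
proof -
  assume x: "x \<in> X"
  have "(\<Sum>j<N. gain (($) x) j) \<le> (\<Sum>j<N. if L dvd j then 1 else 0)"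
    using X_D[OF x] by (intro sum_mono gain_le) auto
  also have "\<dots> = (\<Sum>b<K. \<Sum>j\<in>{b * L..<b * L + L}. if L dvd j then 1 else 0)"
    by (rule sum_blocks[symmetric])
  also have "\<dots> = (\<Sum>b<K. \<Sum>j\<in>{b * L..<b * L + L}. if j = b * L then 1 else 0)"
  proof (intro sum.cong refl if_cong)
    fix b j assume j: "j \<in> {b * L..<b * L + L}"
    show "L dvd j \<longleftrightarrow> j = b * L"
      using block_div[OF j] dvd_div_mult_self[of L j] by (metis dvd_triv_right)
  qed
  also have "\<dots> = real K"
    using L_pos by simp
  finally have "A * (\<Sum>j<N. gain (($) x) j) \<le> A * K"
    using A_pos by (intro mult_left_mono) auto
  moreover have "0 \<le> kap * R * L2_set (link (($) x)) {..<N}"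
    using kap_pos R_pos by simp
  ultimately show ?thesis
    unfolding val_def by simp
qed

lemma val_zero: "val (($) (0\<^sub>v N)) = 0"
proof -
  have "link (($) (0\<^sub>v N)) j = 0" "gain (($) (0\<^sub>v N)) j = 0" if "j < N" for j
    using that by (auto simp: link_def gain_def)
  then show ?thesis
    by (simp add: val_def L2_set_0')
qed

lemma F_in_class:
  assumes "A * K \<le> \<Delta>"
  shows "F \<in> saddle_class l D \<Delta>"
proof -
  have "diam_vec Y \<le> ereal D"
    using diam_ball_le[of N R] by (simp add: Y_def R_def)
  moreover have "primal F (0\<^sub>v N) - (INF x\<in>X. primal F x) \<le> ereal \<Delta>"
  proof -
    have "ereal (- A * K) \<le> (INF x\<in>X. primal F x)"
      using val_ge by (intro INF_greatest) (simp add: primal_F)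
    then have "primal F (0\<^sub>v N) - (INF x\<in>X. primal F x) \<le> 0 - ereal (- A * K)"
      using zero_X val_zero by (intro ereal_minus_mono) (auto simp: primal_F)
    also have "\<dots> \<le> ereal \<Delta>"
      using assms by simp
    finally show ?thesis .
  qed
  ultimately show ?thesis
    unfolding saddle_class_def using differentiable_F smooth_F concave_F by simp
qed

end

subsection \<open>Stationarity and the zero chain\<close>

lemma scalar_prod_self: "scalar_prod v v = (vnorm v)\<^sup>2" for v :: "real vec"
  by (simp only: scalar_prod_def vnorm_sq atLeast0LessThan power2_eq_square[of "v $ _"])

lemma vnorm_minus_smult_sq:
  assumes "d \<in> carrier_vec n" "u \<in> carrier_vec n"
  shows "(vnorm (d - s \<cdot>\<^sub>v u))\<^sup>2 = (vnorm d)\<^sup>2 - 2 * s * scalar_prod d u + s\<^sup>2 * (vnorm u)\<^sup>2"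
proof -
  have "(vnorm (d - s \<cdot>\<^sub>v u))\<^sup>2 = (\<Sum>i<n. (d $ i)\<^sup>2 - 2 * s * (d $ i * u $ i) + s\<^sup>2 * (u $ i)\<^sup>2)"
    unfolding vnorm_sq using assms
    by (intro sum.cong) (auto simp: power2_diff power_mult_distrib)
  also have "\<dots> = (\<Sum>i<n. (d $ i)\<^sup>2) - 2 * s * (\<Sum>i<n. d $ i * u $ i) + s\<^sup>2 * (\<Sum>i<n. (u $ i)\<^sup>2)"
    by (simp add: sum.distrib sum_subtractf sum_distrib_left)
  finally show ?thesis
    using assms by (simp add: vnorm_sq scalar_prod_def atLeast0LessThan)
qed

lemma nat_floor_bounds:
  fixes y :: real
  assumes "y \<ge> 1"
  shows "nat \<lfloor>y\<rfloor> > 0" "real (nat \<lfloor>y\<rfloor>) \<le> y" "y / 2 \<le> real (nat \<lfloor>y\<rfloor>)"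
proof -
  have "real (nat \<lfloor>y\<rfloor>) = of_int \<lfloor>y\<rfloor>" "\<lfloor>y\<rfloor> \<ge> 1"
    using assms by auto
  then show "nat \<lfloor>y\<rfloor> > 0" "real (nat \<lfloor>y\<rfloor>) \<le> y" "y / 2 \<le> real (nat \<lfloor>y\<rfloor>)"
    using floor_correct[of y] by linarith+
qed

section \<open>The Moreau envelope at a stationary point\<close>

context hard_instance
begin

definition env :: "real vec \<Rightarrow> real" where
  "env u = real_of_ereal (moreau l F u)"

lemma moreau_F: "moreau l F u = ereal (env u)"
proof -
  have lower: "ereal (- A * K) \<le> moreau l F u"
    unfolding moreau_def F_simps
  proof (intro INF_greatest)
    fix z
    show "ereal (- A * K) \<le> primal F z + ereal (l * (vnorm (u - z))\<^sup>2)"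
    proof (cases "z \<in> X")
      case True
      have "- A * K \<le> val (($) z)" "0 \<le> l * (vnorm (u - z))\<^sup>2"
        using val_ge[OF True] l_pos by auto
      then show ?thesis
        using True by (simp add: primal_F)
    qed (simp add: primal_F_outside)
  qed
  have "moreau l F u \<le> primal F (0\<^sub>v N) + ereal (l * (vnorm (u - 0\<^sub>v N))\<^sup>2)"
    unfolding moreau_def F_simps by (intro INF_lower) auto
  then have upper: "moreau l F u \<le> ereal (l * (vnorm (u - 0\<^sub>v N))\<^sup>2)"
    using zero_X val_zero by (simp add: primal_F)
  show ?thesis
    using lower upper by (cases "moreau l F u") (auto simp: env_def)
qed

lemma env_le:
  assumes "z \<in> X"
  shows "env u \<le> val (($) z) + l * (vnorm (u - z))\<^sup>2"
proof -
  have "moreau l F u \<le> primal F z + ereal (l * (vnorm (u - z))\<^sup>2)"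
    unfolding moreau_def using X_D(1)[OF assms] by (intro INF_lower) auto
  then show ?thesis
    using assms by (simp add: primal_F moreau_F)
qed

lemma env_approx:
  assumes "\<eta> > 0"
  obtains z where "z \<in> X" "val (($) z) + l * (vnorm (u - z))\<^sup>2 \<le> env u + \<eta>"
proof -
  have "moreau l F u < ereal (env u + \<eta>)"
    using assms by (simp add: moreau_F)
  then obtain z where z: "primal F z + ereal (l * (vnorm (u - z))\<^sup>2) < ereal (env u + \<eta>)"
    unfolding moreau_def INF_less_iff by auto
  then have "z \<in> X"
    using primal_F_outside[of z] by fastforce
  with z show thesis
    by (intro that[of z]) (auto simp: primal_F)
qed

text \<open>
  Near-minimizers suffice for the descent argument, so attainment in the proximal problem is not needed:
  differentiability forces \<open>2 * l \<cdot>\<^sub>v (x - z)\<close> to be close to the gradient of the envelope.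
\<close>
lemma near_minimizer:
  assumes x: "x \<in> carrier_vec N" and g: "has_gradient N (carrier_vec N) env g x"
    and g_le: "vnorm g \<le> eps" and "\<eta>0 > 0"
  obtains z where "z \<in> X" "val (($) z) + l * (vnorm (x - z))\<^sup>2 \<le> env x + \<eta>0" "vnorm (x - z) \<le> eps / l"
proof -
  have gc: "g \<in> carrier_vec N"
    using g by (simp add: has_gradient_def)
  obtain r where r: "r > 0" "\<And>w. w \<in> carrier_vec N \<Longrightarrow> vnorm (w - x) < r \<Longrightarrow>
      \<bar>env w - env x - scalar_prod g (w - x)\<bar> \<le> eps / 4 * vnorm (w - x)"
  proof -
    have "\<forall>e>0. \<exists>d>0. \<forall>w\<in>carrier_vec N. vnorm (w - x) < d \<longrightarrow>
        \<bar>env w - env x - scalar_prod g (w - x)\<bar> \<le> e * vnorm (w - x)"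
      using g unfolding has_gradient_def by simp
    from this[rule_format, of "eps / 4"] show thesis
      using eps_pos that by auto
  qed
  define t where "t = min (r / 2) (eps / (4 * l))"
  have t: "t > 0" "t < r" and "t \<le> eps / (4 * l)"
    using r(1) eps_pos l_pos by (auto simp: t_def)
  then have lt: "l * t \<le> eps / 4"
    using l_pos by (simp add: field_simps)
  \<comment> \<open>Error budget for a step of length \<open>t\<close>: half of
    \<open>eps * t\<close> for the slack \<open>\<eta>\<close>, a quarter for the quadratic term, a
    quarter for differentiability.\<close>
  define \<eta> where "\<eta> = min \<eta>0 (eps * t / 2)"
  have \<eta>: "\<eta> > 0" "\<eta> \<le> \<eta>0" "\<eta> \<le> eps * t / 2"
    using \<open>\<eta>0 > 0\<close> t eps_pos by (auto simp: \<eta>_def)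
  obtain z where z: "z \<in> X" "val (($) z) + l * (vnorm (x - z))\<^sup>2 \<le> env x + \<eta>"
    using env_approx[OF \<eta>(1)] .
  define d where "d = x - z"
  define u where "u = 2 * l \<cdot>\<^sub>v d - g"
  have c: "d \<in> carrier_vec N" "u \<in> carrier_vec N" "z \<in> carrier_vec N"
    using x gc X_D(1)[OF z(1)] by (auto simp: d_def u_def)
  have "vnorm u \<le> eps"
  proof (rule ccontr)
    assume "\<not> vnorm u \<le> eps"
    then have u: "vnorm u > eps" "vnorm u > 0" using eps_pos by auto
    \<comment> \<open>Step from \<open>x\<close> against \<open>u\<close> by length
      \<open>t\<close>. Differentiability bounds the envelope there from below, the fixed point
      \<open>z\<close> from above; both together force \<open>vnorm u \<le> eps\<close>.\<close>
    define s where "s = t / vnorm u"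
    define w where "w = x - s \<cdot>\<^sub>v u"
    have w: "w \<in> carrier_vec N" using x c by (auto simp: w_def)
    have wx: "w - x = (- s) \<cdot>\<^sub>v u"
      using x c by (intro eq_vecI) (auto simp: w_def)
    have nwx: "vnorm (w - x) = t"
      using u t unfolding wx vnorm_smult by (simp add: s_def)
    have wz: "w - z = d - s \<cdot>\<^sub>v u"
      using x c by (intro eq_vecI) (auto simp: w_def d_def)
    have uu: "(vnorm u)\<^sup>2 = 2 * l * scalar_prod d u - scalar_prod g u"
    proof -
      have "(vnorm u)\<^sup>2 = scalar_prod (2 * l \<cdot>\<^sub>v d - g) u"
        unfolding scalar_prod_self[symmetric] by (simp add: u_def)
      also have "\<dots> = 2 * l * scalar_prod d u - scalar_prod g u"
        using c gc by (simp add: minus_scalar_prod_distrib[of _ N])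
      finally show ?thesis .
    qed
    have "\<bar>env w - env x - scalar_prod g (w - x)\<bar> \<le> eps / 4 * t"
      using r(2)[OF w] t(2) by (simp only: nwx)
    then have "env x + scalar_prod g (w - x) - eps / 4 * t \<le> env w"
      by linarith
    also have "env w \<le> val (($) z) + l * (vnorm (w - z))\<^sup>2"
      by (rule env_le[OF z(1)])
    also have "\<dots> = val (($) z) + l * (vnorm d)\<^sup>2 - 2 * l * s * scalar_prod d u + l * t\<^sup>2"
      using u c unfolding wz vnorm_minus_smult_sq[OF c(1,2)]
      by (simp add: s_def power_divide algebra_simps)
    also have "\<dots> \<le> env x + \<eta> - 2 * l * s * scalar_prod d u + l * t\<^sup>2"
      using z(2) by (simp add: d_def)
    finally have "2 * l * s * scalar_prod d u + scalar_prod g (w - x) \<le> \<eta> + l * t\<^sup>2 + eps / 4 * t"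
      by simp
    moreover have "scalar_prod g (w - x) = - s * scalar_prod g u"
      using gc c unfolding wx by simp
    ultimately have "s * (vnorm u)\<^sup>2 \<le> \<eta> + l * t\<^sup>2 + eps / 4 * t"
      unfolding uu by (simp add: algebra_simps)
    moreover have "s * (vnorm u)\<^sup>2 = t * vnorm u"
      using u by (simp add: s_def power2_eq_square)
    moreover have "l * t\<^sup>2 \<le> eps / 4 * t"
      using mult_right_mono[OF lt, of t] t(1) by (simp add: power2_eq_square)
    ultimately have "t * vnorm u \<le> t * eps"
      using \<eta>(3) by (simp add: algebra_simps)
    then show False
      using u t by simp
  qed
  moreover have "2 * l \<cdot>\<^sub>v d = u + g"
    using c gc by (intro eq_vecI) (auto simp: u_def)
  ultimately have "vnorm (2 * l \<cdot>\<^sub>v d) \<le> eps + eps"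
    using vnorm_add_le[of u N g] c gc g_le by simp
  then have "vnorm d \<le> eps / l"
    using l_pos by (simp add: vnorm_smult field_simps)
  then show thesis
    using z \<eta>(2) by (intro that[of z]) (auto simp: d_def)
qed

lemma val_cong:
  assumes "\<And>j. j < N \<Longrightarrow> x j = x' j"
  shows "val x = val x'"
proof -
  have "link x j = link x' j" "gain x j = gain x' j" if "j < N" for j
    using assms that by (auto simp: link_def gain_def gate_def)
  then show ?thesis
    unfolding val_def by (intro arg_cong2[of _ _ _ _ "(-)"] arg_cong2[of _ _ _ _ "(*)"] L2_set_cong sum.cong) auto
qed

text \<open>The near-minimizer is taken with slack \<open>eps\<^sup>2 / (2 * l)\<close>, half of
  what \<open>descent\<close> gains, so the descended point undercuts the envelope.\<close>

lemma not_eps_OS: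
  assumes x0: "x $ (N - 1) = 0"
  shows "\<not> eps_OS l eps F x"
proof
  assume "eps_OS l eps F x"
  then obtain g where "x \<in> X" and g: "has_gradient N (carrier_vec N) env g x" "vnorm g \<le> eps"
    by (auto simp: eps_OS_def moreau_F)
  have xc: "x \<in> carrier_vec N"
    using X_D(1)[OF \<open>x \<in> X\<close>] .
  have \<eta>: "eps\<^sup>2 / (2 * l) > 0"
    using eps_pos l_pos by simp
  obtain z where z: "z \<in> X" "val (($) z) + l * (vnorm (x - z))\<^sup>2 \<le> env x + eps\<^sup>2 / (2 * l)"
    "vnorm (x - z) \<le> eps / l"
    using near_minimizer[OF xc g \<eta>] .
  have zx: "vnorm (x - z) = L2_set (\<lambda>j. z $ j - x $ j) {..<N}"
    using vnorm_minus_commute[OF xc X_D(1)[OF z(1)]] vnorm_minus_eq[OF X_D(1)[OF z(1)] xc] by simp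
  obtain z' where z': "\<And>j. j < N \<Longrightarrow> z' j \<ge> 0"
    "val z' + l * (L2_set (\<lambda>j. z' j - x $ j) {..<N})\<^sup>2
      \<le> val (($) z) + l * (L2_set (\<lambda>j. z $ j - x $ j) {..<N})\<^sup>2 - eps\<^sup>2 / l"
    using descent[of "($) z" "($) x"] X_D(2)[OF z(1)] z(3) x0 unfolding zx by blast
  have z'X: "vec N z' \<in> X"
    using z'(1) by (simp add: X_def)
  have "vnorm (x - vec N z') = L2_set (\<lambda>j. z' j - x $ j) {..<N}"
    using vnorm_minus_commute[OF xc X_D(1)[OF z'X]] vnorm_minus_eq[OF X_D(1)[OF z'X] xc]
    by (auto intro: L2_set_cong)
  moreover have "val (($) (vec N z')) = val z'"
    by (rule val_cong) simp
  ultimately have "env x \<le> env x + eps\<^sup>2 / (2 * l) - eps\<^sup>2 / l"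
    using env_le[OF z'X, of x] z'(2) z(2) unfolding zx by simp
  moreover have "eps\<^sup>2 / l = 2 * (eps\<^sup>2 / (2 * l))"
    by simp
  ultimately show False
    using \<eta> by linarith
qed

text \<open>Each term carries a vanishing factor: \<open>y\<close>, a link, the closed gate in
  \<open>d_cur\<close>, or the ramp of the later coordinate in \<open>d_prev\<close>. Strictness
  \<open>s < j\<close> is needed, as index \<open>s\<close> may be fed by coordinate
  \<open>s - 1\<close>.\<close>

lemma zero_chain_grad:
  assumes "\<And>j. s \<le> j \<Longrightarrow> j < N \<Longrightarrow> x j = 0" "\<And>j. s \<le> j \<Longrightarrow> j < N \<Longrightarrow> y j = 0" "s < j" "j < N"
  shows "grad_x_at x y j = 0" "link x j = 0"
proof -
  have "x (j - 1) = 0" "x j = 0" "y j = 0"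
    using assms by auto
  then have "d_cur x y j = 0" "link x j = 0"
    using assms(3) by (auto simp: d_cur_def link_def gate_def)
  moreover have "d_prev x y (Suc j) = 0" if "Suc j < N"
    using assms that by (auto simp: d_prev_def)
  ultimately show "grad_x_at x y j = 0" "link x j = 0"
    by (auto simp: grad_x_at_def)
qed

text \<open>Query \<open>s\<close> vanishes from index \<open>s\<close> on, so its gradient vanishes
  beyond \<open>s\<close>; the support condition then keeps query \<open>t\<close> zero from index
  \<open>t\<close> on. In the concatenated vector, \<open>j\<close> and \<open>N + j\<close> are the
  \<open>x\<close> and \<open>y\<close> copies of the index.\<close>

lemma query_zero:
  assumes Alg: "Alg \<in> A_zr" and "t \<le> j" "j < N"
  shows "fst (Alg F t) $ j = 0 \<and> snd (Alg F t) $ j = 0"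
  using assms(2,3)
proof (induction t arbitrary: j rule: less_induct)
  case (less t)
  have dom: "fst (Alg F t) \<in> X" "snd (Alg F t) \<in> Y" for t
    using Alg differentiable_F unfolding A_zr_def first_order_algorithm_def
    by (auto simp: mem_Times_iff)
  have start: "Alg F 0 = (0\<^sub>v N, 0\<^sub>v N)"
    and step: "t \<ge> 1 \<Longrightarrow> supp (fst (Alg F t) @\<^sub>v snd (Alg F t)) \<subseteq>
      (\<Union>s<t. supp (grad_x F (fst (Alg F s)) (snd (Alg F s)) @\<^sub>v grad_y F (fst (Alg F s)) (snd (Alg F s))))"
    using Alg differentiable_F unfolding A_zr_def by auto
  show ?case
  proof (cases "t = 0")
    case True
    then show ?thesis using start less.prems by simp
  next
    case False
    have dims: "dim_vec (fst (Alg F t)) = N" "dim_vec (snd (Alg F t)) = N"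
      using X_D(1)[OF dom(1)] Y_D(1)[OF dom(2)] by auto
    have zero: "i \<notin> supp (grad_x F (fst (Alg F s)) (snd (Alg F s)) @\<^sub>v grad_y F (fst (Alg F s)) (snd (Alg F s)))"
      if "s < t" and i: "i = j \<or> i = N + j" for s i
    proof -
      have "grad_x_at (($) (fst (Alg F s))) (($) (snd (Alg F s))) j = 0" "link (($) (fst (Alg F s))) j = 0"
        using less.IH[OF \<open>s < t\<close>] less.prems \<open>s < t\<close>
        by (auto intro!: zero_chain_grad[of s])
      then show ?thesis
        using i less.prems(2)
        by (auto simp: supp_def grad_x_def grad_y_def grad_F[OF dom] grad_vec_def
            vec_first_append vec_last_append)
    qed
    have "j \<notin> supp (fst (Alg F t) @\<^sub>v snd (Alg F t))" "N + j \<notin> supp (fst (Alg F t) @\<^sub>v snd (Alg F t))"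
      using step zero False by (auto dest!: subsetD)
    then show ?thesis
      using less.prems(2) dims by (auto simp: supp_def)
  qed
qed

lemma complexity_ge: "complexity l eps (A_zr \<inter> A_det) {F} \<ge> ereal (real N)"
  unfolding complexity_def
proof (intro INF_greatest)
  fix Alg assume "Alg \<in> A_zr \<inter> A_det"
  then have Alg: "Alg \<in> A_zr" by simp
  have "N \<le> t" if "eps_OS l eps F (fst (Alg F t))" for t
  proof (rule ccontr)
    assume "\<not> N \<le> t"
    then have "fst (Alg F t) $ (N - 1) = 0"
      using query_zero[OF Alg, of t "N - 1"] by auto
    then show False
      using not_eps_OS that by blast
  qed
  then show "ereal (real N) \<le> (SUP f\<in>{F}. INF t\<in>{t. eps_OS l eps f (fst (Alg f t))}. ereal (real t))"
    by (auto intro!: INF_greatest)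
qed

end

section \<open>Choice of constants and block sizes\<close>

theorem theorem3p1:
  shows "\<exists>c0 c1 :: real. c0 > 0 \<and> c1 > 0 \<and>
    (\<forall>l D \<Delta> \<epsilon> :: real.
       l > 0 \<longrightarrow> D > 0 \<longrightarrow> \<Delta> > 0 \<longrightarrow> \<epsilon> > 0 \<longrightarrow>
       \<epsilon> \<le> c0 * min (l * D) (sqrt (l * \<Delta>)) \<longrightarrow>
       (\<exists>f\<in>saddle_class l D \<Delta>.
          complexity l \<epsilon> (A_zr \<inter> A_det) {f} \<ge> ereal (c1 * (l\<^sup>2 * D * \<Delta> / \<epsilon> ^ 3))))"
proof (rule exI[of _ "1 / 224"], rule exI[of _ "1 / (4 * 224 * 27104)"], intro conjI allI impI)
  fix l D \<Delta> \<epsilon> :: real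
  assume pos: "l > 0" "D > 0" "\<Delta> > 0" "\<epsilon> > 0"
    and small: "\<epsilon> \<le> 1 / 224 * min (l * D) (sqrt (l * \<Delta>))"
  \<comment> \<open>\<open>a\<close> is the largest real block length allowed by the locale, and
    \<open>b\<close> is \<open>\<Delta> / A\<close>, the number of blocks that the budget
    \<open>\<Delta>\<close> allows.\<close>
  define a where "a = l * D / (224 * \<epsilon>)"
  define b where "b = l * \<Delta> / (27104 * \<epsilon>\<^sup>2)"
  have "224 * \<epsilon> \<le> l * D" "224 * \<epsilon> \<le> sqrt (l * \<Delta>)"
    using small by auto
  then have "(224 * \<epsilon>)\<^sup>2 \<le> (sqrt (l * \<Delta>))\<^sup>2"
    using pos by (intro power_mono) auto
  \<comment> \<open>50176 is the square of 224 and exceeds 27104 = 616 * 616 / 14, so the same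
    constant guarantees \<open>a \<ge> 1\<close> and \<open>b \<ge> 1\<close>.\<close>
  then have "50176 * \<epsilon>\<^sup>2 \<le> l * \<Delta>"
    using pos by (simp add: power_mult_distrib)
  moreover have "27104 * \<epsilon>\<^sup>2 \<le> 50176 * \<epsilon>\<^sup>2"
    by simp
  ultimately have "27104 * \<epsilon>\<^sup>2 \<le> l * \<Delta>"
    by (rule order_trans[rotated])
  then have ab: "a \<ge> 1" "b \<ge> 1"
    using pos \<open>224 * \<epsilon> \<le> l * D\<close> by (simp_all add: a_def b_def)
  define L K where "L = nat \<lfloor>a\<rfloor>" and "K = nat \<lfloor>b\<rfloor>"
  have L: "L > 0" "real L \<le> a" "a / 2 \<le> real L" and K: "K > 0" "real K \<le> b" "b / 2 \<le> real K"
    using ab nat_floor_bounds[of a] nat_floor_bounds[of b] by (simp_all add: L_def K_def)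
  interpret hard_instance l D \<epsilon> L K
  proof
    show "real L * (224 * \<epsilon>) \<le> l * D"
      using L(2) pos by (simp add: a_def field_simps)
  qed (use pos L K in auto)
  have A: "A = 27104 * \<epsilon>\<^sup>2 / l"
    using pos by (simp add: A_def P_def kap_def power2_eq_square field_simps)
  have "F \<in> saddle_class l D \<Delta>"
  proof (rule F_in_class)
    have "A * K \<le> A * b"
      using K(2) A_pos by (intro mult_left_mono) auto
    also have "\<dots> = \<Delta>"
      using pos by (simp add: A b_def)
    finally show "A * K \<le> \<Delta>" .
  qed
  moreover have "1 / (4 * 224 * 27104) * (l\<^sup>2 * D * \<Delta> / \<epsilon> ^ 3) \<le> real N"
  proof -
    \<comment> \<open>Rounding down a number that is at least 1 loses at most a factor 2; two
      roundings give the 4.\<close>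
    have "1 / (4 * 224 * 27104) * (l\<^sup>2 * D * \<Delta> / \<epsilon> ^ 3) = (b / 2) * (a / 2)"
      by (simp add: a_def b_def power2_eq_square power3_eq_cube mult_ac)
    also have "\<dots> \<le> real K * real L"
      using L K ab by (intro mult_mono) auto
    finally show ?thesis
      by (simp add: N_def)
  qed
  ultimately show "\<exists>f\<in>saddle_class l D \<Delta>.
      complexity l \<epsilon> (A_zr \<inter> A_det) {f} \<ge> ereal (1 / (4 * 224 * 27104) * (l\<^sup>2 * D * \<Delta> / \<epsilon> ^ 3))"
    using complexity_ge by (intro bexI[of _ F]) (auto intro: order_trans[rotated])
qed auto

end
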